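(* Let $[X,\mathcal{B},m,\nu]$ be a reversible random walk space and let $\Omega\in\mathcal{B}$ be $m$-connected with $0<\nu(\Omega)<\nu(\Omega_m)<\infty$, and assume $\Omega$ satisfies a $2$-Poincaré inequality. Then $$T_m(\Omega)=\int_0^\infty \mathbb{Q}_\Omega^m(t)\,dt$$ and $$T_m(\Omega)=\sum_{k=0}^{+\infty}g_{m,\Omega}(k).$$
   Context: A random walk $m$ on a measurable space $(X,\mathcal{B})$ ($\mathcal{B}$ countably generated) is a family $(m_x)_{x\in X}$ of probability measures on $\mathcal{B}$ such that $x\mapsto m_x(B)$ is measurable for each $B\in\mathcal{B}$. A $\sigma$-finite measure $\nu$ on $X$ is reversible if $dm_x(y)d\nu(x)=dm_y(x)d\nu(y)$ as measures on $X\times X$; then $[X,\mathcal{B},m,\nu]$ is called a reversible random walk space. For $A,B\in\mathcal{B}$, $L_m(A,B):=\int_A m_x(B)\,d\nu(x)$. For $\Omega\in\mathcal{B}$: $\partial_m\Omega:=\{x\in X\setminus\Omega: m_x(\Omega)>0\}$ and $\Omega_m:=\Omega\cup\partial_m\Omega$. A set $\Omega\in\mathcal B$ with $\nu(\Omega)>0$ is $m$-connected if $L_m(A,B)>0$ for all measurable $A,B\subset\Omega$ of positive $\nu$-measure with $A\cup B=\Omega$. $\Omega$ satisfies a $2$-Poincaré inequality if there is $\lambda>0$ with $\lambda\int_\Omega|f|^2d\nu\le\int_{\Omega_m}\int_{\Omega_m}|f(y)-f(x)|^2dm_x(y)d\nu(x)$ for all $f\in L^2(\Omega_m,\nu)$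 with $f=0$ $\nu$-a.e. on $\partial_m\Omega$. The $m$-stress function $f_\Omega$ is the unique solution in $L^2(\Omega_m,\nu)$ (equalities $\nu$-a.e.) of $-\int_{\Omega_m}(f_\Omega(y)-f_\Omega(x))\,dm_x(y)=1$ for $x\in\Omega$, $f_\Omega(x)=0$ for $x\in\partial_m\Omega$; it is nonnegative. The $m$-torsional rigidity is $T_m(\Omega):=\int_\Omega f_\Omega\,d\nu$. The spectral $m$-heat content is $\mathbb{Q}_\Omega^m(t):=\int_\Omega v(t,x)\,d\nu(x)$, where $v$ is the solution of $\frac{dv}{dt}(t,x)=\int_{\Omega_m}(v(t,y)-v(t,x))\,dm_x(y)$ for $(t,x)\in(0,\infty)\times\Omega$, $v(t,x)=0$ for $(t,x)\in(0,\infty)\times\partial_m\Omega$, $v(0,x)=1$ for $x\in\Omega$. $g_{m,\Omega}(0):=\nu(\Omega)$ and, for $n\ge1$, $$g_{m,\Omega}(n):=\int_{\Omega^{n+1}}dm_{x_n}(x_{n+1})\cdots dm_{x_1}(x_2)\,d\nu(x_1).$$ *)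

theory Defs
  imports "HOL-Probability.Probability"
begin

(* A single measure \<nu> carries the underlying measurable space:
   X = space \<nu> and the sigma-algebra B = sets \<nu>. *)

definition countably_generated :: "'a measure \<Rightarrow> bool" where
  "countably_generated M \<longleftrightarrow>
     (\<exists>E. countable E \<and> E \<subseteq> Pow (space M) \<and> sets M = sigma_sets (space M) E)"

(* Measurability into prob_algebra M says that every m x is a probability measure on
   sets M and that x \<mapsto> emeasure (m x) B is measurable for every B in sets M. *)
definition random_walk :: "'a measure \<Rightarrow> ('a \<Rightarrow> 'a measure) \<Rightarrow> bool" where
  "random_walk M m \<longleftrightarrow> countably_generated M \<and> m \<in> M \<rightarrow>\<^sub>M prob_algebra M"

(* dm_x(y) d\<nu>(x) = dm_y(x) d\<nu>(y), evaluated on every measurable C in X \<times> X. *)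
definition reversible :: "'a measure \<Rightarrow> ('a \<Rightarrow> 'a measure) \<Rightarrow> bool" where
  "reversible \<nu> m \<longleftrightarrow>
     (\<forall>C \<in> sets (\<nu> \<Otimes>\<^sub>M \<nu>).
        (\<integral>\<^sup>+x. (\<integral>\<^sup>+y. indicator C (x, y) \<partial>m x) \<partial>\<nu>) =
        (\<integral>\<^sup>+y. (\<integral>\<^sup>+x. indicator C (x, y) \<partial>m y) \<partial>\<nu>))"

definition reversible_random_walk_space :: "'a measure \<Rightarrow> ('a \<Rightarrow> 'a measure) \<Rightarrow> bool" where
  "reversible_random_walk_space \<nu> m \<longleftrightarrow>
     random_walk \<nu> m \<and> sigma_finite_measure \<nu> \<and> reversible \<nu> m"

definition interaction ::
    "'a measure \<Rightarrow> ('a \<Rightarrow> 'a measure) \<Rightarrow> 'a set \<Rightarrow> 'a set \<Rightarrow> ennreal" where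
  "interaction \<nu> m A B = (\<integral>\<^sup>+x\<in>A. emeasure (m x) B \<partial>\<nu>)"

definition m_boundary :: "'a measure \<Rightarrow> ('a \<Rightarrow> 'a measure) \<Rightarrow> 'a set \<Rightarrow> 'a set" where
  "m_boundary \<nu> m \<Omega> = {x \<in> space \<nu> - \<Omega>. emeasure (m x) \<Omega> > 0}"

definition m_closure :: "'a measure \<Rightarrow> ('a \<Rightarrow> 'a measure) \<Rightarrow> 'a set \<Rightarrow> 'a set" where
  "m_closure \<nu> m \<Omega> = \<Omega> \<union> m_boundary \<nu> m \<Omega>"

definition m_connected :: "'a measure \<Rightarrow> ('a \<Rightarrow> 'a measure) \<Rightarrow> 'a set \<Rightarrow> bool" where
  "m_connected \<nu> m \<Omega> \<longleftrightarrow>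
     \<Omega> \<in> sets \<nu> \<and> emeasure \<nu> \<Omega> > 0 \<and>
     (\<forall>A \<in> sets \<nu>. \<forall>B \<in> sets \<nu>.
        A \<subseteq> \<Omega> \<longrightarrow> B \<subseteq> \<Omega> \<longrightarrow> emeasure \<nu> A > 0 \<longrightarrow> emeasure \<nu> B > 0 \<longrightarrow> A \<union> B = \<Omega> \<longrightarrow>
        interaction \<nu> m A B > 0)"

(* Functions rather than classes: values outside A are irrelevant. *)
definition L2_on :: "'a measure \<Rightarrow> 'a set \<Rightarrow> ('a \<Rightarrow> real) set" where
  "L2_on \<nu> A =
     {f. set_borel_measurable \<nu> A f \<and> (\<integral>\<^sup>+x\<in>A. ennreal ((f x)\<^sup>2) \<partial>\<nu>) < \<infinity>}"

definition L2_tendsto ::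
    "'a measure \<Rightarrow> 'a set \<Rightarrow> ('b \<Rightarrow> 'a \<Rightarrow> real) \<Rightarrow> ('a \<Rightarrow> real) \<Rightarrow> 'b filter \<Rightarrow> bool" where
  "L2_tendsto \<nu> A u w F \<longleftrightarrow>
     ((\<lambda>s. \<integral>\<^sup>+x\<in>A. ennreal ((u s x - w x)\<^sup>2) \<partial>\<nu>) \<longlongrightarrow> 0) F"

definition poincare2 :: "'a measure \<Rightarrow> ('a \<Rightarrow> 'a measure) \<Rightarrow> 'a set \<Rightarrow> bool" where
  "poincare2 \<nu> m \<Omega> \<longleftrightarrow>
     (\<exists>c>0. \<forall>f \<in> L2_on \<nu> (m_closure \<nu> m \<Omega>).
        (AE x in \<nu>. x \<in> m_boundary \<nu> m \<Omega> \<longrightarrow> f x = 0) \<longrightarrow>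
        ennreal c * (\<integral>\<^sup>+x\<in>\<Omega>. ennreal (\<bar>f x\<bar>\<^sup>2) \<partial>\<nu>)
          \<le> (\<integral>\<^sup>+x\<in>m_closure \<nu> m \<Omega>.
               (\<integral>\<^sup>+y\<in>m_closure \<nu> m \<Omega>. ennreal (\<bar>f y - f x\<bar>\<^sup>2) \<partial>m x) \<partial>\<nu>))"

definition is_stress_function ::
    "'a measure \<Rightarrow> ('a \<Rightarrow> 'a measure) \<Rightarrow> 'a set \<Rightarrow> ('a \<Rightarrow> real) \<Rightarrow> bool" where
  "is_stress_function \<nu> m \<Omega> f \<longleftrightarrow>
     f \<in> L2_on \<nu> (m_closure \<nu> m \<Omega>) \<and>
     (AE x in \<nu>. x \<in> \<Omega> \<longrightarrow> - (LINT y:m_closure \<nu> m \<Omega>|m x. f y - f x) = 1) \<and>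
     (AE x in \<nu>. x \<in> m_boundary \<nu> m \<Omega> \<longrightarrow> f x = 0)"

(* SOME rather than THE: uniqueness of the solution is only up to \<nu>-null sets. *)
definition stress_function ::
    "'a measure \<Rightarrow> ('a \<Rightarrow> 'a measure) \<Rightarrow> 'a set \<Rightarrow> 'a \<Rightarrow> real" where
  "stress_function \<nu> m \<Omega> = (SOME f. is_stress_function \<nu> m \<Omega> f)"

definition torsional_rigidity ::
    "'a measure \<Rightarrow> ('a \<Rightarrow> 'a measure) \<Rightarrow> 'a set \<Rightarrow> real" where
  "torsional_rigidity \<nu> m \<Omega> = (LINT x:\<Omega>|\<nu>. stress_function \<nu> m \<Omega> x)"

(* Strong L2 solution: t \<mapsto> v t is continuous on [0, \<infinity>) and differentiable on (0, \<infinity>)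
   as a curve in L2(\<Omega>, \<nu>), with the nonlocal Laplacian of v t as its derivative. *)
definition is_heat_solution ::
    "'a measure \<Rightarrow> ('a \<Rightarrow> 'a measure) \<Rightarrow> 'a set \<Rightarrow> (real \<Rightarrow> 'a \<Rightarrow> real) \<Rightarrow> bool" where
  "is_heat_solution \<nu> m \<Omega> v \<longleftrightarrow>
     (\<forall>t\<ge>0. v t \<in> L2_on \<nu> (m_closure \<nu> m \<Omega>)) \<and>
     (\<forall>t\<ge>0. L2_tendsto \<nu> \<Omega> v (v t) (at t within {0..})) \<and>
     (\<forall>t>0. L2_tendsto \<nu> \<Omega> (\<lambda>s x. (v s x - v t x) / (s - t))
               (\<lambda>x. LINT y:m_closure \<nu> m \<Omega>|m x. v t y - v t x) (at t)) \<and>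
     (\<forall>t>0. AE x in \<nu>. x \<in> m_boundary \<nu> m \<Omega> \<longrightarrow> v t x = 0) \<and>
     (AE x in \<nu>. x \<in> \<Omega> \<longrightarrow> v 0 x = 1)"

(* SOME: as for stress_function. *)
definition heat_solution ::
    "'a measure \<Rightarrow> ('a \<Rightarrow> 'a measure) \<Rightarrow> 'a set \<Rightarrow> real \<Rightarrow> 'a \<Rightarrow> real" where
  "heat_solution \<nu> m \<Omega> = (SOME v. is_heat_solution \<nu> m \<Omega> v)"

definition spectral_heat_content ::
    "'a measure \<Rightarrow> ('a \<Rightarrow> 'a measure) \<Rightarrow> 'a set \<Rightarrow> real \<Rightarrow> real" where
  "spectral_heat_content \<nu> m \<Omega> t = (LINT x:\<Omega>|\<nu>. heat_solution \<nu> m \<Omega> t x)"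

(* walk_mass m \<Omega> n x is the integral of dm_{x_n}(x_{n+1}) ... dm_{x_1}(x_2) over
   (x_2, ..., x_{n+1}) in \<Omega>^n, with x_1 = x. *)
primrec walk_mass :: "('a \<Rightarrow> 'a measure) \<Rightarrow> 'a set \<Rightarrow> nat \<Rightarrow> 'a \<Rightarrow> real" where
  "walk_mass m \<Omega> 0 x = 1"
| "walk_mass m \<Omega> (Suc n) x = (LINT y:\<Omega>|m x. walk_mass m \<Omega> n y)"

definition g_seq :: "'a measure \<Rightarrow> ('a \<Rightarrow> 'a measure) \<Rightarrow> 'a set \<Rightarrow> nat \<Rightarrow> real" where
  "g_seq \<nu> m \<Omega> n =
     (if n = 0 then measure \<nu> \<Omega> else (LINT x:\<Omega>|\<nu>. walk_mass m \<Omega> n x))"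

end

theory Submission
  imports Defs
begin

text \<open>Let $Kf(x) = \int_\Omega f\,dm_x$ be the transition operator of the walk killed outside
  $\Omega$; reversibility makes it symmetric on $L^2(\Omega,\nu)$. The stress function solves
  $f - Kf = 1$ and the heat equation is $v' = Kv - v$.

  The Poincar\'e inequality bounds the partial sums of $\sum_k K^k 1$ in $L^2$, so the potential
  $S = \sum_k K^k 1$ lies in $L^2$ and solves $S - KS = 1$. Any other solution $f$ has the same
  integral, since $\int f = \langle f, S - KS\rangle = \langle f - Kf, S\rangle = \int S$,
  and $\int_\Omega K^k 1\,d\nu = g_{m,\Omega}(k)$.

  For the heat content, the pairings $a_k(t) = \langle v(t), K^k 1\rangle$ satisfy
  $a_k' = a_{k+1} - a_k$ and $a_k(0) = g_{m,\Omega}(k)$, which forces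
  $\mathbb{Q}(t) = a_0(t) = e^{-t}\sum_k g_{m,\Omega}(k)\,t^k/k!$. Integrating
  term by term gives $\sum_k g_{m,\Omega}(k)$ again.\<close>

section \<open>Reversible kernels\<close>

text \<open>Stress function and heat solution are picked by \<open>SOME\<close>, so each is known
  only through the predicate it satisfies. Existence therefore needs an explicit witness, and the
  integral has to be computed for an arbitrary solution. Both computations are scalar: the solution
  is paired with \<open>potential\<close> or with the iterates K^k 1, and symmetry moves K to the
  other factor. Two obstacles precede this. The equations integrate over \<Omega>_m, while K sees
  only \<Omega>; passing from one to the other uses that the walk started in \<Omega> almost surely
  lands in \<Omega>_m, a consequence of reversibility. And solutions are functions fixed only up to
  null sets, so \<nu>-a.e. statements must also be usable under \<open>m x\<close>; this holds
  because \<nu> is invariant. Both facts are read off from the joint law of one jump, a measure on X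
  x X whose two marginals are \<nu>.\<close>

locale reversible_walk =
  fixes \<nu> :: "'a measure" and m :: "'a \<Rightarrow> 'a measure"
  assumes kernel: "m \<in> \<nu> \<rightarrow>\<^sub>M prob_algebra \<nu>"
    and reversible: "reversible \<nu> m"
    and space_nonempty: "space \<nu> \<noteq> {}"
begin

lemma kernel_subprob [measurable]: "m \<in> \<nu> \<rightarrow>\<^sub>M subprob_algebra \<nu>"
  using kernel by (rule measurable_prob_algebraD)

lemma prob_space_kernel: "x \<in> space \<nu> \<Longrightarrow> prob_space (m x)"
  using measurable_space[OF kernel] by (auto simp: space_prob_algebra)

lemma sets_kernel_eq [measurable_cong]: "x \<in> space \<nu> \<Longrightarrow> sets (m x) = sets \<nu>"
  using measurable_space[OF kernel] by (auto simp: space_prob_algebra)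

lemma space_kernel_eq: "x \<in> space \<nu> \<Longrightarrow> space (m x) = space \<nu>"
  by (rule sets_eq_imp_space_eq) (rule sets_kernel_eq)

lemma measurable_kernel_eq:
  "x \<in> space \<nu> \<Longrightarrow> measurable (m x) N = measurable \<nu> N"
  by (intro measurable_cong_sets sets_kernel_eq refl)

text \<open>The measure $dm_x(y)\,d\nu(x)$ on $X \times X$.\<close>

definition jump :: "('a \<times> 'a) measure" where
  "jump = \<nu> \<bind> (\<lambda>x. distr (m x) (\<nu> \<Otimes>\<^sub>M \<nu>) (Pair x))"

lemma jump_kernel: "(\<lambda>x. distr (m x) (\<nu> \<Otimes>\<^sub>M \<nu>) (Pair x)) \<in> \<nu> \<rightarrow>\<^sub>M subprob_algebra (\<nu> \<Otimes>\<^sub>M \<nu>)"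
  by (rule measurable_distr2[where M = \<nu>]) auto

lemma sets_jump [measurable_cong, simp]: "sets jump = sets (\<nu> \<Otimes>\<^sub>M \<nu>)"
  \<comment> \<open>Over an empty space \<open>bind\<close> defaults to
    \<open>count_space {}\<close>, hence the locale assumption
    \<open>space_nonempty\<close>.\<close>
  unfolding jump_def using space_nonempty by (intro sets_bind) auto

lemma nn_integral_jump:
  assumes [measurable]: "F \<in> borel_measurable (\<nu> \<Otimes>\<^sub>M \<nu>)"
  shows "(\<integral>\<^sup>+p. F p \<partial>jump) = (\<integral>\<^sup>+x. \<integral>\<^sup>+y. F (x, y) \<partial>m x \<partial>\<nu>)"
proof -
  have "(\<integral>\<^sup>+p. F p \<partial>distr (m x) (\<nu> \<Otimes>\<^sub>M \<nu>) (Pair x)) = (\<integral>\<^sup>+y. F (x, y) \<partial>m x)"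
    if x [simp]: "x \<in> space \<nu>" for x
  proof -
    have [measurable]: "Pair x \<in> m x \<rightarrow>\<^sub>M \<nu> \<Otimes>\<^sub>M \<nu>"
      by (simp add: measurable_kernel_eq)
    show ?thesis by (rule nn_integral_distr) measurable
  qed
  then show ?thesis
    unfolding jump_def by (subst nn_integral_bind[OF _ jump_kernel]) (auto intro!: nn_integral_cong)
qed

text \<open>Turns the set-wise hypothesis into an equality of measures, so that every later exchange
  of x and y is a change of variables under \<open>jump\<close>.\<close>

lemma distr_jump_swap: "distr jump (\<nu> \<Otimes>\<^sub>M \<nu>) (\<lambda>p. (snd p, fst p)) = jump"
proof (rule measure_eqI)
  fix C assume "C \<in> sets (distr jump (\<nu> \<Otimes>\<^sub>M \<nu>) (\<lambda>p. (snd p, fst p)))"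
  then have C [measurable]: "C \<in> sets (\<nu> \<Otimes>\<^sub>M \<nu>)" by simp
  have "emeasure (distr jump (\<nu> \<Otimes>\<^sub>M \<nu>) (\<lambda>p. (snd p, fst p))) C
      = (\<integral>\<^sup>+p. indicator C p \<partial>distr jump (\<nu> \<Otimes>\<^sub>M \<nu>) (\<lambda>p. (snd p, fst p)))"
    by (rule nn_integral_indicator[symmetric]) simp
  also have "\<dots> = (\<integral>\<^sup>+p. indicator C (snd p, fst p) \<partial>jump)"
    by (rule nn_integral_distr) simp_all
  also have "\<dots> = (\<integral>\<^sup>+y. \<integral>\<^sup>+x. indicator C (x, y) \<partial>m y \<partial>\<nu>)"
    by (subst nn_integral_jump) simp_all
  also have "\<dots> = (\<integral>\<^sup>+x. \<integral>\<^sup>+y. indicator C (x, y) \<partial>m x \<partial>\<nu>)"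
    using reversible C unfolding reversible_def by simp
  also have "\<dots> = (\<integral>\<^sup>+p. indicator C p \<partial>jump)"
    by (subst nn_integral_jump) simp_all
  finally show "emeasure (distr jump (\<nu> \<Otimes>\<^sub>M \<nu>) (\<lambda>p. (snd p, fst p))) C = emeasure jump C"
    by simp
qed simp

lemma nn_integral_jump_swap:
  assumes [measurable]: "F \<in> borel_measurable (\<nu> \<Otimes>\<^sub>M \<nu>)"
  shows "(\<integral>\<^sup>+p. F (snd p, fst p) \<partial>jump) = (\<integral>\<^sup>+p. F p \<partial>jump)"
  by (subst (2) distr_jump_swap[symmetric], subst nn_integral_distr) simp_all

lemma nn_integral_jump_fst:
  assumes [measurable]: "f \<in> borel_measurable \<nu>"
  shows "(\<integral>\<^sup>+p. f (fst p) \<partial>jump) = (\<integral>\<^sup>+x. f x \<partial>\<nu>)"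
proof -
  have "(\<integral>\<^sup>+y. f x \<partial>m x) = f x" if "x \<in> space \<nu>" for x
    using prob_space.emeasure_space_1[OF prob_space_kernel[OF that]] by simp
  then show ?thesis by (subst nn_integral_jump) (auto intro!: nn_integral_cong)
qed

text \<open>Invariance of \<open>\<nu>\<close>: exchanging coordinates reduces the second marginal
  of \<open>jump\<close> to the first, which is \<open>\<nu>\<close> because each \<open>m x\<close>
  has mass one.\<close>

lemma nn_integral_jump_snd:
  assumes [measurable]: "f \<in> borel_measurable \<nu>"
  shows "(\<integral>\<^sup>+p. f (snd p) \<partial>jump) = (\<integral>\<^sup>+x. f x \<partial>\<nu>)"
  using nn_integral_jump_swap[of "\<lambda>p. f (fst p)"] nn_integral_jump_fst[of f] by simp

lemma integral_jump_swap:
  fixes F :: "'a \<times> 'a \<Rightarrow> real"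
  assumes [measurable]: "F \<in> borel_measurable (\<nu> \<Otimes>\<^sub>M \<nu>)"
  shows "(LINT p|jump. F (snd p, fst p)) = (LINT p|jump. F p)"
  by (subst (2) distr_jump_swap[symmetric], subst integral_distr) simp_all

text \<open>Fubini for the kernel, nonnegative case: the inner extended integrals have a finite
  integral, so they are finite a.e. and agree there with the Bochner integrals.\<close>

lemma integral_jump_nonneg:
  fixes F :: "'a \<times> 'a \<Rightarrow> real"
  assumes F: "integrable jump F" and nonneg: "\<And>p. 0 \<le> F p"
  shows "AE x in \<nu>. integrable (m x) (\<lambda>y. F (x, y))"
    and "integrable \<nu> (\<lambda>x. LINT y|m x. F (x, y))"
    and "(LINT p|jump. F p) = (LINT x|\<nu>. LINT y|m x. F (x, y))"
proof -
  have [measurable]: "F \<in> borel_measurable (\<nu> \<Otimes>\<^sub>M \<nu>)"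
    using borel_measurable_integrable[OF F]
    by (simp add: measurable_cong_sets[OF sets_jump refl])
  have sect [measurable]: "(\<lambda>y. F (x, y)) \<in> borel_measurable (m x)" if "x \<in> space \<nu>" for x
    using that by (simp add: measurable_kernel_eq)
  have [measurable]: "(\<lambda>x. \<integral>\<^sup>+y. ennreal (F (x, y)) \<partial>m x) \<in> borel_measurable \<nu>"
    by (rule nn_integral_measurable_subprob_algebra2[where N = \<nu>]) simp_all
  have eq: "(\<integral>\<^sup>+x. \<integral>\<^sup>+y. ennreal (F (x, y)) \<partial>m x \<partial>\<nu>) = ennreal (LINT p|jump. F p)"
    using nn_integral_eq_integral[OF F] nonneg nn_integral_jump[of "\<lambda>p. ennreal (F p)"] by simp
  then have fin: "AE x in \<nu>. (\<integral>\<^sup>+y. ennreal (F (x, y)) \<partial>m x) \<noteq> \<infinity>"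
    by (intro nn_integral_noteq_infinite) auto
  show int: "AE x in \<nu>. integrable (m x) (\<lambda>y. F (x, y))"
    using fin AE_space
    by eventually_elim (use nonneg in \<open>auto intro!: integrableI_bounded simp: less_top\<close>)
  have ae: "AE x in \<nu>. (\<integral>\<^sup>+y. ennreal (F (x, y)) \<partial>m x) = ennreal (LINT y|m x. F (x, y))"
    using int by eventually_elim (rule nn_integral_eq_integral, auto simp: nonneg)
  have "(LINT y|m x. F (x, y)) = enn2real (\<integral>\<^sup>+y. ennreal (F (x, y)) \<partial>m x)" if "x \<in> space \<nu>" for x
    using that nonneg by (intro integral_eq_nn_integral) auto
  then have meas: "(\<lambda>x. LINT y|m x. F (x, y)) \<in> borel_measurable \<nu>"
    by (subst measurable_cong) auto
  have eq': "(\<integral>\<^sup>+x. ennreal (LINT y|m x. F (x, y)) \<partial>\<nu>) = ennreal (LINT p|jump. F p)"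
    using eq nn_integral_cong_AE[OF ae] by simp
  show int2: "integrable \<nu> (\<lambda>x. LINT y|m x. F (x, y))"
    using meas eq' nonneg by (intro integrableI_nn_integral_finite) auto
  show "(LINT p|jump. F p) = (LINT x|\<nu>. LINT y|m x. F (x, y))"
    using eq' nonneg by (subst (asm) nn_integral_eq_integral[OF int2]) (auto simp: Bochner_Integration.integral_nonneg)
qed

lemma integral_jump:
  fixes F :: "'a \<times> 'a \<Rightarrow> real"
  assumes F: "integrable jump F"
  shows "AE x in \<nu>. integrable (m x) (\<lambda>y. F (x, y))"
    and "integrable \<nu> (\<lambda>x. LINT y|m x. F (x, y))"
    and "(LINT p|jump. F p) = (LINT x|\<nu>. LINT y|m x. F (x, y))"
proof -
  let ?P = "\<lambda>p. max 0 (F p)" and ?N = "\<lambda>p. max 0 (- F p)"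
  have F_eq: "F = (\<lambda>p. ?P p - ?N p)" by (auto simp: max_def)
  have int: "integrable jump ?P" "integrable jump ?N" using F by auto
  note P = integral_jump_nonneg[OF int(1), simplified]
    and N = integral_jump_nonneg[OF int(2), simplified]
  show "AE x in \<nu>. integrable (m x) (\<lambda>y. F (x, y))"
    using P(1) N(1) by eventually_elim (subst F_eq, auto)
  have meas [measurable]: "F \<in> borel_measurable (\<nu> \<Otimes>\<^sub>M \<nu>)"
    using borel_measurable_integrable[OF F] by (simp add: measurable_cong_sets[OF sets_jump refl])
  have ae: "AE x in \<nu>. (LINT y|m x. F (x, y)) = (LINT y|m x. ?P (x, y)) - (LINT y|m x. ?N (x, y))"
    using P(1) N(1) by eventually_elim (subst F_eq, simp)
  \<comment> \<open>The splitting \<open>ae\<close> holds only almost everywhere and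
    \<open>\<nu>\<close> need not be complete, so measurability is taken from the kernel
    directly.\<close>
  have m1: "(\<lambda>x. LINT y|m x. F (x, y)) \<in> borel_measurable \<nu>"
  proof -
    have "(\<lambda>x. integral\<^sup>L (distr (m x) (\<nu> \<Otimes>\<^sub>M \<nu>) (Pair x)) F) \<in> borel_measurable \<nu>"
      by (rule measurable_compose[OF jump_kernel integral_measurable_subprob_algebra[OF meas]])
    moreover have "integral\<^sup>L (distr (m x) (\<nu> \<Otimes>\<^sub>M \<nu>) (Pair x)) F = (LINT y|m x. F (x, y))"
      if "x \<in> space \<nu>" for x
      using that by (intro integral_distr) (simp_all add: measurable_kernel_eq)
    ultimately show ?thesis by (simp cong: measurable_cong)
  qed
  have d: "integrable \<nu> (\<lambda>x. (LINT y|m x. ?P (x, y)) - (LINT y|m x. ?N (x, y)))"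
    using P(2) N(2) by auto
  show "integrable \<nu> (\<lambda>x. LINT y|m x. F (x, y))"
    using integrable_cong_AE[OF m1 borel_measurable_integrable[OF d] ae] d by simp
  have "(LINT x|\<nu>. LINT y|m x. F (x, y))
      = (LINT x|\<nu>. (LINT y|m x. ?P (x, y)) - (LINT y|m x. ?N (x, y)))"
    by (rule integral_cong_AE[OF m1 borel_measurable_integrable[OF d] ae])
  also have "\<dots> = (LINT p|jump. ?P p - ?N p)"
    using P N int by simp
  finally show "(LINT p|jump. F p) = (LINT x|\<nu>. LINT y|m x. F (x, y))"
    using F_eq by metis
qed

text \<open>By invariance, a \<open>\<nu>\<close>-null set N has \<open>jump\<close>-mass zero in
  the second coordinate, so \<open>m x\<close> charges N only for x in a null set. This brings
  boundary conditions and summability under the integral against \<open>m x\<close>.\<close>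

lemma AE_kernel:
  assumes "AE y in \<nu>. Q y"
  shows "AE x in \<nu>. AE y in m x. Q y"
proof -
  obtain N where N: "N \<in> null_sets \<nu>" "{y \<in> space \<nu>. \<not> Q y} \<subseteq> N"
    using assms by (auto simp: eventually_ae_filter)
  have [measurable]: "N \<in> sets \<nu>" using N(1) by auto
  have "(\<integral>\<^sup>+x. \<integral>\<^sup>+y. indicator N y \<partial>m x \<partial>\<nu>) = (\<integral>\<^sup>+p. indicator N (snd p) \<partial>jump)"
    by (subst nn_integral_jump) simp_all
  also have "\<dots> = 0"
    using N(1) by (subst nn_integral_jump_snd) auto
  finally have "AE x in \<nu>. (\<integral>\<^sup>+y. indicator N y \<partial>m x) = 0"
    by (subst (asm) nn_integral_0_iff_AE) simp_all
  then show ?thesis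
    using AE_space
  proof eventually_elim
    case (elim x)
    then have "N \<in> null_sets (m x)" by (auto simp: sets_kernel_eq)
    then show ?case
      using N(2) elim(2) by (intro AE_I'[of N]) (auto simp: space_kernel_eq)
  qed
qed

end

section \<open>The killed walk\<close>

lemma L2_onD:
  assumes "f \<in> L2_on M A"
  shows "(\<lambda>x. indicator A x * f x) \<in> borel_measurable M"
    and "integrable M (\<lambda>x. (indicator A x * f x)\<^sup>2)"
proof -
  show meas: "(\<lambda>x. indicator A x * f x) \<in> borel_measurable M"
    using assms by (simp add: L2_on_def set_borel_measurable_def)
  have "(\<integral>\<^sup>+x. ennreal ((indicator A x * f x)\<^sup>2) \<partial>M) = (\<integral>\<^sup>+x\<in>A. ennreal ((f x)\<^sup>2) \<partial>M)"
    by (intro nn_integral_cong) (auto split: split_indicator)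
  also have "\<dots> < \<infinity>" using assms by (simp add: L2_on_def)
  finally show "integrable M (\<lambda>x. (indicator A x * f x)\<^sup>2)"
    using meas by (intro integrableI_bounded) auto
qed

lemma L2_onI:
  assumes "(\<lambda>x. indicator A x * f x) \<in> borel_measurable M"
    and "integrable M (\<lambda>x. (indicator A x * f x)\<^sup>2)"
  shows "f \<in> L2_on M A"
proof -
  have "(\<integral>\<^sup>+x\<in>A. ennreal ((f x)\<^sup>2) \<partial>M) = (\<integral>\<^sup>+x. ennreal ((indicator A x * f x)\<^sup>2) \<partial>M)"
    by (intro nn_integral_cong) (auto split: split_indicator)
  also have "\<dots> < \<infinity>"
    using nn_integral_eq_integral[OF assms(2)] by simp
  finally show ?thesis
    using assms(1) by (simp add: L2_on_def set_borel_measurable_def)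
qed

lemma L2_on_bounded:
  fixes f :: "'a \<Rightarrow> real"
  assumes [measurable]: "(\<lambda>x. indicator A x * f x) \<in> borel_measurable M" "A \<in> sets M"
    and fin: "emeasure M A < \<infinity>" and bnd: "\<And>x. x \<in> A \<Longrightarrow> \<bar>f x\<bar> \<le> B"
  shows "f \<in> L2_on M A"
proof (rule L2_onI)
  have "norm ((indicator A x * f x)\<^sup>2) \<le> B\<^sup>2" if "x \<in> A" for x
    using that bnd[OF that] power_mono[of "\<bar>f x\<bar>" B 2] by simp
  then show "integrable M (\<lambda>x. (indicator A x * f x)\<^sup>2)"
    using fin by (intro integrableI_bounded_set[where A = A and B = "B\<^sup>2"]) auto
qed fact

lemma L2_on_mono:
  assumes f: "f \<in> L2_on M B" and AB: "A \<subseteq> B" and [measurable]: "A \<in> sets M"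
  shows "f \<in> L2_on M A"
proof (rule L2_onI)
  note [measurable] = L2_onD(1)[OF f]
  have eq: "(\<lambda>x. indicator A x * f x) = (\<lambda>x. indicator A x * (indicator B x * f x))"
    using AB by (auto simp: fun_eq_iff split: split_indicator)
  show meas: "(\<lambda>x. indicator A x * f x) \<in> borel_measurable M"
    unfolding eq by measurable
  show "integrable M (\<lambda>x. (indicator A x * f x)\<^sup>2)"
    using meas
    by (intro Bochner_Integration.integrable_bound[OF L2_onD(2)[OF f]])
       (use AB in \<open>auto split: split_indicator\<close>)
qed

lemma set_integrable_L2_on:
  assumes f: "f \<in> L2_on M A" and [measurable]: "A \<in> sets M" and fin: "emeasure M A < \<infinity>"
  shows "set_integrable M A f"
  unfolding set_integrable_def
proof (rule Bochner_Integration.integrable_bound)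
  show "integrable M (\<lambda>x. indicator A x + (indicator A x * f x)\<^sup>2 :: real)"
    using L2_onD(2)[OF f] fin by (intro Bochner_Integration.integrable_add) auto
  have "\<bar>z\<bar> \<le> 1 + z\<^sup>2" for z :: real
    using zero_le_power2[of "\<bar>z\<bar> - 1"] by (simp add: power2_eq_square algebra_simps)
  then show "AE x in M. norm (indicator A x *\<^sub>R f x) \<le> norm (indicator A x + (indicator A x * f x)\<^sup>2 :: real)"
    by (intro AE_I2) (auto split: split_indicator)
  show "(\<lambda>x. indicator A x *\<^sub>R f x) \<in> borel_measurable M" using L2_onD(1)[OF f] by simp
qed

lemma abs_mult_le_sum_squares: "\<bar>a * b\<bar> \<le> a\<^sup>2 + b\<^sup>2" for a b :: real
proof -
  have "2 * (\<bar>a\<bar> * \<bar>b\<bar>) \<le> a\<^sup>2 + b\<^sup>2"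
    using sum_squares_bound[of "\<bar>a\<bar>" "\<bar>b\<bar>"] by simp
  moreover have "0 \<le> \<bar>a\<bar> * \<bar>b\<bar>" by simp
  ultimately show ?thesis unfolding abs_mult by linarith
qed

lemma set_integral_indicator_mult:
  fixes f g :: "'a \<Rightarrow> real"
  shows "(LINT x:A|M. f x * g x) = (LINT x|M. (indicator A x * f x) * (indicator A x * g x))"
  unfolding set_lebesgue_integral_def
  by (intro Bochner_Integration.integral_cong) (auto split: split_indicator)

section \<open>The killed transition operator and its quadratic form\<close>

locale walk_domain = reversible_walk +
  fixes \<Omega> :: "'a set"
  assumes sets_domain [measurable, simp]: "\<Omega> \<in> sets \<nu>"
    and finite_closure: "emeasure \<nu> (m_closure \<nu> m \<Omega>) < \<infinity>"
begin

text \<open>The operator K of the overview, defined for every f and x; where f is not integrable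
  over \<open>\<Omega>\<close> under \<open>m x\<close> it takes the default value 0.\<close>

definition killed :: "('a \<Rightarrow> real) \<Rightarrow> 'a \<Rightarrow> real" where
  "killed f x = (LINT y:\<Omega>|m x. f y)"

lemma sets_boundary [measurable, simp]: "m_boundary \<nu> m \<Omega> \<in> sets \<nu>"
proof -
  have [measurable]: "(\<lambda>x. emeasure (m x) \<Omega>) \<in> borel_measurable \<nu>"
    by (rule measurable_compose[OF kernel_subprob measurable_emeasure_subprob_algebra]) simp
  have "m_boundary \<nu> m \<Omega> = {x \<in> space \<nu>. emeasure (m x) \<Omega> > 0} - \<Omega>"
    by (auto simp: m_boundary_def)
  also have "\<dots> \<in> sets \<nu>" by measurable
  finally show ?thesis .
qed

lemma sets_closure [measurable, simp]: "m_closure \<nu> m \<Omega> \<in> sets \<nu>"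
  by (simp add: m_closure_def)

lemma domain_subset_closure: "\<Omega> \<subseteq> m_closure \<nu> m \<Omega>"
  by (simp add: m_closure_def)

lemma domain_space: "x \<in> \<Omega> \<Longrightarrow> x \<in> space \<nu>"
  using sets.sets_into_space[OF sets_domain] by auto

lemma finite_domain: "emeasure \<nu> \<Omega> < \<infinity>"
  using emeasure_mono[OF domain_subset_closure sets_closure] finite_closure by (rule le_less_trans)

lemma L2_on_closureD: "f \<in> L2_on \<nu> (m_closure \<nu> m \<Omega>) \<Longrightarrow> f \<in> L2_on \<nu> \<Omega>"
  by (rule L2_on_mono[OF _ domain_subset_closure]) auto

lemma L2_on_const: "(\<lambda>_. c) \<in> L2_on \<nu> \<Omega>"
  using finite_domain by (intro L2_on_bounded[where B = "\<bar>c\<bar>"]) auto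

text \<open>F(x) G(y) is dominated by F(x)^2 + G(y)^2, and both marginals of \<open>jump\<close> are
  \<open>\<nu>\<close>. This does the work of boundedness of K on L2: pairings with
  \<open>killed\<close> become integrals against \<open>jump\<close>.\<close>

lemma integrable_jump_mult:
  assumes f: "f \<in> L2_on \<nu> \<Omega>" and g: "g \<in> L2_on \<nu> \<Omega>"
  shows "integrable jump (\<lambda>p. (indicator \<Omega> (fst p) * f (fst p)) * (indicator \<Omega> (snd p) * g (snd p)))"
proof -
  define F G where "F x = indicator \<Omega> x * f x" and "G x = indicator \<Omega> x * g x" for x
  have [measurable]: "F \<in> borel_measurable \<nu>" "G \<in> borel_measurable \<nu>"
    using L2_onD(1)[OF f] L2_onD(1)[OF g] by (simp_all add: F_def[abs_def] G_def[abs_def])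
  have F2: "integrable \<nu> (\<lambda>x. (F x)\<^sup>2)" and G2: "integrable \<nu> (\<lambda>x. (G x)\<^sup>2)"
    using L2_onD(2)[OF f] L2_onD(2)[OF g] by (simp_all add: F_def G_def)
  have "integrable jump (\<lambda>p. (F (fst p))\<^sup>2)"
    using nn_integral_jump_fst[of "\<lambda>x. ennreal ((F x)\<^sup>2)"] nn_integral_eq_integral[OF F2]
    by (intro integrableI_bounded) simp_all
  moreover have "integrable jump (\<lambda>p. (G (snd p))\<^sup>2)"
    using nn_integral_jump_snd[of "\<lambda>x. ennreal ((G x)\<^sup>2)"] nn_integral_eq_integral[OF G2]
    by (intro integrableI_bounded) simp_all
  ultimately have sq: "integrable jump (\<lambda>p. (F (fst p))\<^sup>2 + (G (snd p))\<^sup>2)"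
    by (rule Bochner_Integration.integrable_add)
  have "integrable jump (\<lambda>p. F (fst p) * G (snd p))"
    by (rule Bochner_Integration.integrable_bound[OF sq]) (simp_all add: abs_mult_le_sum_squares)
  then show ?thesis by (simp add: F_def G_def)
qed

lemma integrable_mult_killed:
  assumes f: "f \<in> L2_on \<nu> \<Omega>" and g: "g \<in> L2_on \<nu> \<Omega>"
  shows "set_integrable \<nu> \<Omega> (\<lambda>x. f x * killed g x)"
  using integral_jump(2)[OF integrable_jump_mult[OF f g]]
  by (simp add: set_integrable_def killed_def set_lebesgue_integral_def mult.assoc)

lemma integral_mult_killed:
  assumes f: "f \<in> L2_on \<nu> \<Omega>" and g: "g \<in> L2_on \<nu> \<Omega>"
  shows "(LINT x:\<Omega>|\<nu>. f x * killed g x)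
    = (LINT p|jump. (indicator \<Omega> (fst p) * f (fst p)) * (indicator \<Omega> (snd p) * g (snd p)))"
  using integral_jump(3)[OF integrable_jump_mult[OF f g]]
  by (simp add: killed_def set_lebesgue_integral_def mult.assoc)

text \<open>The two pairings are the same integral against \<open>jump\<close> with the coordinates
  exchanged.\<close>

lemma killed_symmetric:
  assumes f: "f \<in> L2_on \<nu> \<Omega>" and g: "g \<in> L2_on \<nu> \<Omega>"
  shows "(LINT x:\<Omega>|\<nu>. f x * killed g x) = (LINT x:\<Omega>|\<nu>. killed f x * g x)"
proof -
  note [measurable] = L2_onD(1)[OF f] L2_onD(1)[OF g]
  have "(LINT x:\<Omega>|\<nu>. killed f x * g x) = (LINT x:\<Omega>|\<nu>. g x * killed f x)"
    by (simp add: mult.commute)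
  also have "\<dots> = (LINT p|jump. (indicator \<Omega> (snd p) * g (snd p)) * (indicator \<Omega> (fst p) * f (fst p)))"
    unfolding integral_mult_killed[OF g f]
    by (subst integral_jump_swap[symmetric]) simp_all
  also have "\<dots> = (LINT x:\<Omega>|\<nu>. f x * killed g x)"
    unfolding integral_mult_killed[OF f g] by (simp add: mult.commute)
  finally show ?thesis by simp
qed

text \<open>Pairing with the constant 1, which is in L2 since \<open>\<Omega>\<close> has finite
  measure, makes almost every section integrable; there \<open>killed f\<close> is a genuine
  integral and not a default value.\<close>

lemma set_integrable_kernel:
  assumes f: "f \<in> L2_on \<nu> \<Omega>"
  shows "AE x in \<nu>. x \<in> \<Omega> \<longrightarrow> set_integrable (m x) \<Omega> f"
  using integral_jump(1)[OF integrable_jump_mult[OF L2_on_const[of 1] f]]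
  by eventually_elim (auto simp: set_integrable_def)

lemma integrable_killed: "f \<in> L2_on \<nu> \<Omega> \<Longrightarrow> set_integrable \<nu> \<Omega> (killed f)"
  using integrable_mult_killed[OF L2_on_const[of 1]] by simp

text \<open>Reversibility gives $L_m(\Omega, X \setminus \Omega_m) = L_m(X \setminus \Omega_m, \Omega) = 0$.\<close>

lemma kernel_closure: "AE x in \<nu>. x \<in> \<Omega> \<longrightarrow> (AE y in m x. y \<in> m_closure \<nu> m \<Omega>)"
proof -
  let ?D = "space \<nu> - m_closure \<nu> m \<Omega>"
  have "(\<integral>\<^sup>+x. \<integral>\<^sup>+y. indicator \<Omega> x * indicator ?D y \<partial>m x \<partial>\<nu>)
      = (\<integral>\<^sup>+p. indicator \<Omega> (fst p) * indicator ?D (snd p) \<partial>jump)"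
    by (subst nn_integral_jump) simp_all
  also have "\<dots> = (\<integral>\<^sup>+p. indicator \<Omega> (snd p) * indicator ?D (fst p) \<partial>jump)"
    by (subst nn_integral_jump_swap[symmetric]) simp_all
  also have "\<dots> = (\<integral>\<^sup>+x. \<integral>\<^sup>+y. indicator \<Omega> y * indicator ?D x \<partial>m x \<partial>\<nu>)"
    by (subst nn_integral_jump) simp_all
  also have "\<dots> = (\<integral>\<^sup>+x. 0 \<partial>\<nu>)"
  proof (rule nn_integral_cong)
    fix x assume x: "x \<in> space \<nu>"
    then have "emeasure (m x) \<Omega> = 0" if "x \<notin> m_closure \<nu> m \<Omega>"
      using that by (auto simp: m_closure_def m_boundary_def)
    with x show "(\<integral>\<^sup>+y. indicator \<Omega> y * indicator ?D x \<partial>m x) = 0"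
      by (auto split: split_indicator simp: sets_kernel_eq)
  qed
  finally have "(\<integral>\<^sup>+x. \<integral>\<^sup>+y. indicator \<Omega> x * indicator ?D y \<partial>m x \<partial>\<nu>) = 0" by simp
  moreover have "(\<lambda>x. \<integral>\<^sup>+y. indicator \<Omega> x * indicator ?D y \<partial>m x) \<in> borel_measurable \<nu>"
    by (rule nn_integral_measurable_subprob_algebra2[where N = \<nu>]) simp_all
  ultimately have "AE x in \<nu>. (\<integral>\<^sup>+y. indicator \<Omega> x * indicator ?D y \<partial>m x) = 0"
    by (subst (asm) nn_integral_0_iff_AE) simp_all
  then show ?thesis
  proof eventually_elim
    case (elim x)
    show ?case
    proof
      assume x: "x \<in> \<Omega>"
      then have D: "?D \<in> sets (m x)" by (simp add: sets_kernel_eq domain_space)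
      have "?D \<in> null_sets (m x)" using elim x D by (simp add: null_sets_def)
      then show "AE y in m x. y \<in> m_closure \<nu> m \<Omega>"
        by (rule AE_I') (use x in \<open>auto simp: space_kernel_eq domain_space\<close>)
    qed
  qed
qed

text \<open>For a.e. x in \<open>\<Omega>\<close>, \<open>m x\<close> lives on \<Omega>_m and f
  vanishes \<open>m x\<close>-a.e. on the boundary, so only \<open>\<Omega>\<close> contributes to
  the integral of f; since \<open>m x\<close> has mass one, f(x) integrates to itself.\<close>

lemma laplacian_eq_killed:
  assumes f: "f \<in> L2_on \<nu> (m_closure \<nu> m \<Omega>)"
    and bd: "AE x in \<nu>. x \<in> m_boundary \<nu> m \<Omega> \<longrightarrow> f x = 0"
  shows "AE x in \<nu>. x \<in> \<Omega> \<longrightarrow> (LINT y:m_closure \<nu> m \<Omega>|m x. f y - f x) = killed f x - f x"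
  using kernel_closure set_integrable_kernel[OF L2_on_closureD[OF f]] AE_kernel[OF bd]
proof eventually_elim
  case (elim x)
  show ?case
  proof
    assume x: "x \<in> \<Omega>"
    interpret prob_space "m x" using x by (intro prob_space_kernel domain_space)
    have int: "integrable (m x) (\<lambda>y. indicator \<Omega> y * f y)"
      using elim(2) x by (simp add: set_integrable_def)
    have meas: "(\<lambda>y. indicator (m_closure \<nu> m \<Omega>) y * (f y - f x)) \<in> borel_measurable (m x)"
    proof -
      note [measurable] = L2_onD(1)[OF f]
      have "(\<lambda>y. indicator (m_closure \<nu> m \<Omega>) y * f y - indicator (m_closure \<nu> m \<Omega>) y * f x)
          \<in> borel_measurable \<nu>"
        by measurable
      then show ?thesis
        using x by (simp add: measurable_kernel_eq domain_space right_diff_distrib)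
    qed
    have "(LINT y:m_closure \<nu> m \<Omega>|m x. f y - f x) = (LINT y|m x. indicator \<Omega> y * f y - f x)"
      unfolding set_lebesgue_integral_def real_scaleR_def
    proof (rule integral_cong_AE[OF meas])
      show "AE y in m x. indicator (m_closure \<nu> m \<Omega>) y * (f y - f x) = indicator \<Omega> y * f y - f x"
        using elim(1)[rule_format, OF x] elim(3)
        by eventually_elim (auto simp: m_closure_def split: split_indicator)
    qed (use int in auto)
    also have "\<dots> = killed f x - f x"
      using int by (simp add: killed_def set_lebesgue_integral_def prob_space)
    finally show "(LINT y:m_closure \<nu> m \<Omega>|m x. f y - f x) = killed f x - f x" .
  qed
qed

text \<open>A spectral gap for I - K: for f extended by zero, the energy over X x X expands to
  2<f,f> - 2<f,Kf>, as both marginals of \<open>jump\<close> are \<open>\<nu>\<close>. Enlarging the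
  domain from \<Omega>_m to X only increases the energy, so the lower bound persists.\<close>

lemma poincare_killed:
  assumes "poincare2 \<nu> m \<Omega>"
  obtains c where "c > 0"
    "\<And>f. f \<in> L2_on \<nu> \<Omega> \<Longrightarrow>
       c * (LINT x:\<Omega>|\<nu>. f x * f x) + 2 * (LINT x:\<Omega>|\<nu>. f x * killed f x)
         \<le> 2 * (LINT x:\<Omega>|\<nu>. f x * f x)"
proof -
  let ?cl = "m_closure \<nu> m \<Omega>"
  obtain c where c: "c > 0" and poincare: "\<And>f. f \<in> L2_on \<nu> ?cl \<Longrightarrow>
        (AE x in \<nu>. x \<in> m_boundary \<nu> m \<Omega> \<longrightarrow> f x = 0) \<Longrightarrow>
        ennreal c * (\<integral>\<^sup>+x\<in>\<Omega>. ennreal (\<bar>f x\<bar>\<^sup>2) \<partial>\<nu>)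
          \<le> (\<integral>\<^sup>+x\<in>?cl. (\<integral>\<^sup>+y\<in>?cl. ennreal (\<bar>f y - f x\<bar>\<^sup>2) \<partial>m x) \<partial>\<nu>)"
    using assms unfolding poincare2_def by blast
  have "c * (LINT x:\<Omega>|\<nu>. f x * f x) + 2 * (LINT x:\<Omega>|\<nu>. f x * killed f x)
         \<le> 2 * (LINT x:\<Omega>|\<nu>. f x * f x)" if f: "f \<in> L2_on \<nu> \<Omega>" for f
  proof -
    define F where "F x = indicator \<Omega> x * f x" for x
    have [measurable]: "F \<in> borel_measurable \<nu>"
      using L2_onD(1)[OF f] by (simp add: F_def[abs_def])
    have F2: "integrable \<nu> (\<lambda>x. (F x)\<^sup>2)"
      using L2_onD(2)[OF f] by (simp add: F_def)
    have "F \<in> L2_on \<nu> ?cl"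
    proof (rule L2_onI)
      have eq: "(\<lambda>x. indicator ?cl x * F x) = F"
        using domain_subset_closure by (auto simp: F_def fun_eq_iff split: split_indicator)
      show "(\<lambda>x. indicator ?cl x * F x) \<in> borel_measurable \<nu>"
        unfolding eq by measurable
      show "integrable \<nu> (\<lambda>x. (indicator ?cl x * F x)\<^sup>2)"
        using F2 by (simp only: fun_cong[OF eq])
    qed
    moreover have "AE x in \<nu>. x \<in> m_boundary \<nu> m \<Omega> \<longrightarrow> F x = 0"
      by (auto simp: F_def m_boundary_def)
    ultimately have le: "ennreal c * (\<integral>\<^sup>+x\<in>\<Omega>. ennreal (\<bar>F x\<bar>\<^sup>2) \<partial>\<nu>)
        \<le> (\<integral>\<^sup>+x\<in>?cl. (\<integral>\<^sup>+y\<in>?cl. ennreal (\<bar>F y - F x\<bar>\<^sup>2) \<partial>m x) \<partial>\<nu>)"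
      by (rule poincare)
    have int1: "integrable jump (\<lambda>p. (F (fst p))\<^sup>2)"
      using nn_integral_jump_fst[of "\<lambda>x. ennreal ((F x)\<^sup>2)"] nn_integral_eq_integral[OF F2]
      by (intro integrableI_bounded) simp_all
    have int2: "integrable jump (\<lambda>p. (F (snd p))\<^sup>2)"
      using nn_integral_jump_snd[of "\<lambda>x. ennreal ((F x)\<^sup>2)"] nn_integral_eq_integral[OF F2]
      by (intro integrableI_bounded) simp_all
    have int3: "integrable jump (\<lambda>p. F (fst p) * F (snd p))"
      using integrable_jump_mult[OF f f] by (simp add: F_def)
    define A where "A = (LINT x|\<nu>. (F x)\<^sup>2)"
    have A: "A = (LINT x:\<Omega>|\<nu>. f x * f x)"
      unfolding set_integral_indicator_mult A_def by (simp add: F_def power2_eq_square)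
    have A1: "(LINT p|jump. (F (fst p))\<^sup>2) = A"
      unfolding A_def using nn_integral_jump_fst[of "\<lambda>x. ennreal ((F x)\<^sup>2)"]
      by (simp add: integral_eq_nn_integral)
    have A2: "(LINT p|jump. (F (snd p))\<^sup>2) = A"
      unfolding A_def using nn_integral_jump_snd[of "\<lambda>x. ennreal ((F x)\<^sup>2)"]
      by (simp add: integral_eq_nn_integral)
    have B: "(LINT p|jump. F (fst p) * F (snd p)) = (LINT x:\<Omega>|\<nu>. f x * killed f x)"
      unfolding integral_mult_killed[OF f f] by (simp add: F_def)
    have exp: "(F (snd p) - F (fst p))\<^sup>2
        = (F (fst p))\<^sup>2 + (F (snd p))\<^sup>2 - 2 * (F (fst p) * F (snd p))" for p
      by (simp add: power2_eq_square algebra_simps)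
    have int: "integrable jump (\<lambda>p. (F (snd p) - F (fst p))\<^sup>2)"
      unfolding exp using int1 int2 int3 by auto
    have energy: "(LINT p|jump. (F (snd p) - F (fst p))\<^sup>2)
        = 2 * A - 2 * (LINT x:\<Omega>|\<nu>. f x * killed f x)"
      unfolding exp using int1 int2 int3 by (simp add: A1 A2 B)
    have "ennreal (c * A) = ennreal c * (\<integral>\<^sup>+x. ennreal ((F x)\<^sup>2) \<partial>\<nu>)"
      using c nn_integral_eq_integral[OF F2] by (simp add: A_def ennreal_mult)
    also have "(\<integral>\<^sup>+x. ennreal ((F x)\<^sup>2) \<partial>\<nu>) = (\<integral>\<^sup>+x\<in>\<Omega>. ennreal (\<bar>F x\<bar>\<^sup>2) \<partial>\<nu>)"
      by (intro nn_integral_cong) (auto simp: F_def split: split_indicator)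
    also note le
    also have "(\<integral>\<^sup>+x\<in>?cl. (\<integral>\<^sup>+y\<in>?cl. ennreal (\<bar>F y - F x\<bar>\<^sup>2) \<partial>m x) \<partial>\<nu>)
        \<le> (\<integral>\<^sup>+x. \<integral>\<^sup>+y. ennreal ((F y - F x)\<^sup>2) \<partial>m x \<partial>\<nu>)"
      by (auto intro!: nn_integral_mono split: split_indicator)
    also have "\<dots> = (\<integral>\<^sup>+p. ennreal ((F (snd p) - F (fst p))\<^sup>2) \<partial>jump)"
      by (subst nn_integral_jump) simp_all
    also have "\<dots> = ennreal (LINT p|jump. (F (snd p) - F (fst p))\<^sup>2)"
      by (rule nn_integral_eq_integral[OF int]) simp
    also note energy
    finally have "ennreal (c * A) \<le> ennreal (2 * A - 2 * (LINT x:\<Omega>|\<nu>. f x * killed f x))" .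
    \<comment> \<open>\<open>ennreal\<close> sends negative reals to 0, so the inequality descends
      to the reals only with a nonnegative right-hand side.\<close>
    moreover have "0 \<le> (LINT p|jump. (F (snd p) - F (fst p))\<^sup>2)" by simp
    ultimately have "c * A \<le> 2 * A - 2 * (LINT x:\<Omega>|\<nu>. f x * killed f x)"
      unfolding energy by (simp add: ennreal_le_iff)
    then show ?thesis by (simp add: A)
  qed
  with c show ?thesis using that by blast
qed

end

section \<open>The potential and the torsional rigidity\<close>

lemma set_integral_cong_AE_integrable:
  fixes f g :: "'a \<Rightarrow> real"
  assumes "set_integrable M A f" "set_integrable M A g" and "AE x in M. x \<in> A \<longrightarrow> f x = g x"
  shows "(LINT x:A|M. f x) = (LINT x:A|M. g x)"
  unfolding set_lebesgue_integral_def
proof (rule integral_cong_AE)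
  show "AE x in M. indicator A x *\<^sub>R f x = indicator A x *\<^sub>R g x"
    using assms(3) by eventually_elim (auto split: split_indicator)
qed (use assms(1,2) in \<open>auto simp: set_integrable_def\<close>)

lemma set_integrable_mult_L2_on:
  assumes f: "f \<in> L2_on M A" and g: "g \<in> L2_on M A"
  shows "set_integrable M A (\<lambda>x. f x * g x)"
proof -
  define F G where "F x = indicator A x * f x" and "G x = indicator A x * g x" for x
  have [measurable]: "F \<in> borel_measurable M" "G \<in> borel_measurable M"
    using L2_onD(1)[OF f] L2_onD(1)[OF g] by (simp_all add: F_def[abs_def] G_def[abs_def])
  have sq: "integrable M (\<lambda>x. (F x)\<^sup>2 + (G x)\<^sup>2)"
    using L2_onD(2)[OF f] L2_onD(2)[OF g] by (simp add: F_def G_def)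
  have "integrable M (\<lambda>x. F x * G x)"
    by (rule Bochner_Integration.integrable_bound[OF sq]) (simp_all add: abs_mult_le_sum_squares)
  moreover have "(\<lambda>x. indicator A x *\<^sub>R (f x * g x)) = (\<lambda>x. F x * G x)"
    by (auto simp: F_def G_def split: split_indicator)
  ultimately show ?thesis by (simp add: set_integrable_def)
qed

lemma set_integral_finite_sum:
  fixes f :: "'b \<Rightarrow> 'a \<Rightarrow> real"
  assumes "\<And>k. k \<in> I \<Longrightarrow> set_integrable M A (f k)"
  shows "(LINT x:A|M. \<Sum>k\<in>I. f k x) = (\<Sum>k\<in>I. LINT x:A|M. f k x)"
  using assms unfolding set_lebesgue_integral_def set_integrable_def scaleR_sum_right
  by (rule Bochner_Integration.integral_sum)

section \<open>Iterates of the killed operator and their sum\<close>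

context walk_domain
begin

lemma set_integral_domain_const: "(LINT x:\<Omega>|\<nu>. b) = measure \<nu> \<Omega> * b" for b :: real
  using finite_domain by (simp add: set_lebesgue_integral_def)

lemma set_integrable_domain_const: "set_integrable \<nu> \<Omega> (\<lambda>x. b)" for b :: real
  using set_integrable_L2_on[OF L2_on_const sets_domain finite_domain] .

abbreviation w :: "nat \<Rightarrow> 'a \<Rightarrow> real" where
  "w \<equiv> walk_mass m \<Omega>"

text \<open>Identifies \<open>w k\<close> with K^k 1 of the overview, at every point and not only on
  \<open>\<Omega>\<close>.\<close>

lemma killed_walk_mass: "killed (w k) = w (Suc k)"
  by (simp add: killed_def fun_eq_iff)

declare walk_mass.simps(2) [simp del]

lemma measurable_walk_mass [measurable]: "w k \<in> borel_measurable \<nu>"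
proof (induction k)
  case (Suc k)
  then have [measurable]: "(\<lambda>y. indicator \<Omega> y *\<^sub>R w k y) \<in> borel_measurable \<nu>" by measurable
  show ?case
    unfolding walk_mass.simps(2)[abs_def] set_lebesgue_integral_def
    by (rule measurable_compose[OF kernel_subprob integral_measurable_subprob_algebra]) fact
qed (simp add: walk_mass.simps(1)[abs_def])

text \<open>The killed walk is sub-Markov. The bound is uniform in k, as needed for the power series
  \<open>poisson_mean\<close> and for using \<open>w k\<close> as a test function in
  \<open>L2_tendsto_integral\<close>.\<close>

lemma walk_mass_bounds: "x \<in> space \<nu> \<Longrightarrow> 0 \<le> w k x \<and> w k x \<le> 1"
proof (induction k arbitrary: x)
  case (Suc k)
  interpret prob_space "m x" using Suc.prems by (rule prob_space_kernel)
  have b: "0 \<le> indicator \<Omega> y *\<^sub>R w k y \<and> indicator \<Omega> y *\<^sub>R w k y \<le> 1" for y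
    using Suc.IH domain_space by (auto split: split_indicator)
  have meas: "(\<lambda>y. indicator \<Omega> y *\<^sub>R w k y) \<in> borel_measurable (m x)"
    using Suc.prems by (simp add: measurable_kernel_eq)
  have "integrable (m x) (\<lambda>y. indicator \<Omega> y *\<^sub>R w k y)"
    using b meas by (intro integrable_const_bound[where B = 1] AE_I2) auto
  then have "(LINT y|m x. indicator \<Omega> y *\<^sub>R w k y) \<le> (LINT y|m x. 1)"
    using b by (intro integral_mono) auto
  then show ?case
    using b by (simp add: walk_mass.simps(2) set_lebesgue_integral_def prob_space Bochner_Integration.integral_nonneg)
qed simp

lemma walk_mass_bounds_domain: "x \<in> \<Omega> \<Longrightarrow> 0 \<le> w k x" "x \<in> \<Omega> \<Longrightarrow> w k x \<le> 1"
  using walk_mass_bounds domain_space by auto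

lemma L2_on_walk_mass: "w k \<in> L2_on \<nu> \<Omega>"
  using finite_domain walk_mass_bounds_domain by (intro L2_on_bounded[where B = 1]) auto

lemma L2_on_sum_walk_mass: "(\<lambda>x. \<Sum>k<n. w k x) \<in> L2_on \<nu> \<Omega>"
proof (rule L2_on_bounded[where B = n])
  fix x assume "x \<in> \<Omega>"
  then have "(\<Sum>k<n. w k x) \<le> (\<Sum>k<n. 1)"
    by (intro sum_mono walk_mass_bounds_domain)
  moreover have "0 \<le> (\<Sum>k<n. w k x)"
    using \<open>x \<in> \<Omega>\<close> by (intro sum_nonneg walk_mass_bounds_domain)
  ultimately show "\<bar>\<Sum>k<n. w k x\<bar> \<le> n" by simp
qed (use finite_domain in auto)

lemma set_integrable_walk_mass: "set_integrable \<nu> \<Omega> (w k)"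
  using set_integrable_L2_on[OF L2_on_walk_mass sets_domain finite_domain] .

lemma set_integrable_kernel_walk_mass:
  assumes x: "x \<in> space \<nu>"
  shows "set_integrable (m x) \<Omega> (w k)"
proof -
  interpret prob_space "m x" using x by (rule prob_space_kernel)
  show ?thesis
    unfolding set_integrable_def using x walk_mass_bounds_domain
    by (intro integrable_const_bound[where B = 1] AE_I2)
       (auto simp: measurable_kernel_eq split: split_indicator)
qed

lemma g_seq_eq: "g_seq \<nu> m \<Omega> k = (LINT x:\<Omega>|\<nu>. w k x)"
  using finite_domain by (simp add: g_seq_def set_lebesgue_integral_def)

lemma g_seq_nonneg: "0 \<le> g_seq \<nu> m \<Omega> k"
  unfolding g_seq_eq set_lebesgue_integral_def
  using walk_mass_bounds_domain by (intro Bochner_Integration.integral_nonneg) (auto split: split_indicator)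

lemma killed_sum_walk_mass:
  assumes "x \<in> space \<nu>"
  shows "killed (\<lambda>y. \<Sum>k<n. w k y) x = (\<Sum>k<n. w (Suc k) x)"
  using set_integral_finite_sum[OF set_integrable_kernel_walk_mass[OF assms]]
  by (simp add: killed_def walk_mass.simps(2))

text \<open>The partial sums satisfy $K s_n \ge s_n - 1$; testing the Poincar\'e inequality
  on $s_n$ therefore bounds $\|s_n\|_2^2$ by a multiple of $\int_\Omega s_n\,d\nu$.\<close>

lemma sum_walk_mass_bound:
  assumes "poincare2 \<nu> m \<Omega>"
  obtains C where "\<And>n. (LINT x:\<Omega>|\<nu>. (\<Sum>k<n. w k x) * (\<Sum>k<n. w k x)) \<le> C"
proof -
  obtain c where c: "c > 0" and poincare: "\<And>f. f \<in> L2_on \<nu> \<Omega> \<Longrightarrow>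
       c * (LINT x:\<Omega>|\<nu>. f x * f x) + 2 * (LINT x:\<Omega>|\<nu>. f x * killed f x)
         \<le> 2 * (LINT x:\<Omega>|\<nu>. f x * f x)"
    using poincare_killed[OF assms] by blast
  have "(LINT x:\<Omega>|\<nu>. (\<Sum>k<n. w k x) * (\<Sum>k<n. w k x)) \<le> 4 * measure \<nu> \<Omega> / c\<^sup>2" for n
  proof -
    define s where "s x = (\<Sum>k<n. w k x)" for x
    have s: "s \<in> L2_on \<nu> \<Omega>" using L2_on_sum_walk_mass by (simp add: s_def[abs_def])
    have int_s: "set_integrable \<nu> \<Omega> s"
      using set_integrable_L2_on[OF s sets_domain finite_domain] .
    have int_ss: "set_integrable \<nu> \<Omega> (\<lambda>x. s x * s x)"
      using set_integrable_mult_L2_on[OF s s] .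
    define A where "A = (LINT x:\<Omega>|\<nu>. s x * s x)"
    have "A - (LINT x:\<Omega>|\<nu>. s x) = (LINT x:\<Omega>|\<nu>. s x * s x - s x)"
      using int_s int_ss by (simp add: A_def)
    also have "\<dots> \<le> (LINT x:\<Omega>|\<nu>. s x * killed s x)"
    proof (rule set_integral_mono)
      show "set_integrable \<nu> \<Omega> (\<lambda>x. s x * s x - s x)" using int_s int_ss by simp
      show "set_integrable \<nu> \<Omega> (\<lambda>x. s x * killed s x)" by (rule integrable_mult_killed[OF s s])
      fix x assume x: "x \<in> \<Omega>"
      \<comment> \<open>\<open>killed\<close> shifts the sum by one index: it loses
        \<open>w 0 x = 1\<close> and gains the nonnegative \<open>w n x\<close>.\<close>
      have "killed s x = s x - 1 + w n x"
        using x sum.lessThan_Suc_shift[of "\<lambda>k. w k x" n]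
        by (simp add: s_def[abs_def] killed_sum_walk_mass domain_space)
      then have "s x - 1 \<le> killed s x" using walk_mass_bounds_domain(1)[OF x] by simp
      moreover have "0 \<le> s x" using x walk_mass_bounds_domain(1) by (auto simp: s_def intro: sum_nonneg)
      ultimately have "s x * (s x - 1) \<le> s x * killed s x" by (rule mult_left_mono)
      then show "s x * s x - s x \<le> s x * killed s x" by (simp add: algebra_simps)
    qed
    finally have "c * A \<le> 2 * (LINT x:\<Omega>|\<nu>. s x)"
      using poincare[OF s] by (simp add: A_def)
    also have "\<dots> = (LINT x:\<Omega>|\<nu>. 2 * s x)" by simp
    \<comment> \<open>Young's inequality, weighted so that half of \<open>c * A\<close> is absorbed
      on the left; the remaining \<open>c / 2 * A\<close> is at most
      \<open>2 / c * measure \<nu> \<Omega>\<close>, whence the constant. Absorption is legitimate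
      because the partial sum is bounded, so \<open>A\<close> is finite.\<close>
    also have "\<dots> \<le> (LINT x:\<Omega>|\<nu>. c / 2 * (s x * s x) + 2 / c)"
    proof (rule set_integral_mono)
      fix x
      have "0 \<le> c / 2 * (s x - 2 / c)\<^sup>2" using c by simp
      also have "\<dots> = c / 2 * (s x * s x) + 2 / c - 2 * s x"
        using c by (simp add: power2_eq_square field_simps)
      finally show "2 * s x \<le> c / 2 * (s x * s x) + 2 / c" by simp
    qed (use int_s int_ss set_integrable_domain_const in auto)
    also have "\<dots> = c / 2 * A + 2 / c * measure \<nu> \<Omega>"
      using int_ss set_integrable_domain_const by (simp add: A_def set_integral_domain_const)
    finally have "c / 2 * A \<le> 2 / c * measure \<nu> \<Omega>" by simp
    then have "A \<le> 4 * measure \<nu> \<Omega> / c\<^sup>2"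
      using c by (simp add: field_simps power2_eq_square)
    then show ?thesis by (simp add: A_def s_def)
  qed
  then show ?thesis using that by blast
qed

lemma set_integral_sum_walk_mass:
  "(LINT x:\<Omega>|\<nu>. \<Sum>k<n. w k x) = (\<Sum>k<n. g_seq \<nu> m \<Omega> k)"
  using set_integral_finite_sum[OF set_integrable_walk_mass] by (simp add: g_seq_eq)

text \<open>On a set of finite measure the L2 bound for the partial sums gives an L1 bound, and
  their integrals are the partial sums of this nonnegative series.\<close>

lemma summable_g_seq:
  assumes "poincare2 \<nu> m \<Omega>"
  shows "summable (g_seq \<nu> m \<Omega>)"
proof -
  obtain C where C: "\<And>n. (LINT x:\<Omega>|\<nu>. (\<Sum>k<n. w k x) * (\<Sum>k<n. w k x)) \<le> C"
    using sum_walk_mass_bound[OF assms] by blast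
  have "(\<Sum>k<n. g_seq \<nu> m \<Omega> k) \<le> C + measure \<nu> \<Omega>" for n
  proof -
    define s where "s x = (\<Sum>k<n. w k x)" for x
    have s: "s \<in> L2_on \<nu> \<Omega>" using L2_on_sum_walk_mass by (simp add: s_def[abs_def])
    have int_s: "set_integrable \<nu> \<Omega> s"
      using set_integrable_L2_on[OF s sets_domain finite_domain] .
    have int_ss: "set_integrable \<nu> \<Omega> (\<lambda>x. s x * s x)"
      using set_integrable_mult_L2_on[OF s s] .
    have "(\<Sum>k<n. g_seq \<nu> m \<Omega> k) = (LINT x:\<Omega>|\<nu>. s x)"
      by (simp add: s_def set_integral_sum_walk_mass)
    also have "\<dots> \<le> (LINT x:\<Omega>|\<nu>. s x * s x + 1)"
    proof (rule set_integral_mono)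
      fix x
      \<comment> \<open>The right-hand side is twice s^2 - s + 1.\<close>
      have "0 \<le> (s x - 1)\<^sup>2 + s x * s x + 1" by simp
      then show "s x \<le> s x * s x + 1" by (simp add: power2_eq_square algebra_simps)
    qed (use int_s int_ss set_integrable_domain_const in auto)
    also have "\<dots> = (LINT x:\<Omega>|\<nu>. s x * s x) + measure \<nu> \<Omega>"
      using int_ss set_integrable_domain_const by (simp add: set_integral_domain_const)
    also have "\<dots> \<le> C + measure \<nu> \<Omega>" using C by (simp add: s_def)
    finally show ?thesis .
  qed
  then show ?thesis using g_seq_nonneg by (intro summableI_nonneg_bounded) auto
qed

text \<open>For x in \<open>\<Omega>\<close> this is the expected exit time: \<open>w k x\<close> is
  the probability that the first k steps stay in \<open>\<Omega>\<close>. The real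
  \<open>suminf\<close> is meaningful only where the series converges.\<close>

definition potential :: "'a \<Rightarrow> real" where
  "potential x = (\<Sum>k. w k x)"

lemma indicator_potential: "indicator \<Omega> x * potential x = (\<Sum>k. indicator \<Omega> x * w k x)"
  by (auto simp: potential_def split: split_indicator)

text \<open>The extended-real sum has integral equal to the sum of \<open>g_seq\<close>, which is
  finite; hence it is finite almost everywhere.\<close>

lemma AE_summable_walk_mass:
  assumes "poincare2 \<nu> m \<Omega>"
  shows "AE x in \<nu>. x \<in> \<Omega> \<longrightarrow> summable (\<lambda>k. w k x)"
proof -
  have nonneg: "0 \<le> indicator \<Omega> x * w k x" for k x
    using walk_mass_bounds_domain by (auto split: split_indicator)
  have int: "integrable \<nu> (\<lambda>x. indicator \<Omega> x * w k x)" for k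
    using set_integrable_walk_mass by (simp add: set_integrable_def)
  have eq: "(\<integral>\<^sup>+x. ennreal (indicator \<Omega> x * w k x) \<partial>\<nu>) = ennreal (g_seq \<nu> m \<Omega> k)" for k
    using nn_integral_eq_integral[OF int[of k]] nonneg by (simp add: g_seq_eq set_lebesgue_integral_def)
  have "(\<integral>\<^sup>+x. (\<Sum>k. ennreal (indicator \<Omega> x * w k x)) \<partial>\<nu>) = (\<Sum>k. ennreal (g_seq \<nu> m \<Omega> k))"
    by (subst nn_integral_suminf) (simp_all add: eq)
  also have "\<dots> \<noteq> \<infinity>"
    using ennreal_suminf_neq_top[OF summable_g_seq[OF assms] g_seq_nonneg] by simp
  finally have "AE x in \<nu>. (\<Sum>k. ennreal (indicator \<Omega> x * w k x)) \<noteq> \<infinity>"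
    by (intro nn_integral_noteq_infinite) auto
  then show ?thesis
  proof eventually_elim
    case (elim x)
    then have "summable (\<lambda>k. indicator \<Omega> x * w k x)"
      using nonneg by (intro summable_suminf_not_top) auto
    then show ?case by auto
  qed
qed

lemma set_integral_potential:
  assumes "poincare2 \<nu> m \<Omega>"
  shows "set_integrable \<nu> \<Omega> potential" and "(LINT x:\<Omega>|\<nu>. potential x) = (\<Sum>k. g_seq \<nu> m \<Omega> k)"
proof -
  let ?f = "\<lambda>k x. indicator \<Omega> x * w k x"
  have norm_eq: "norm (?f k x) = ?f k x" for k x
    using walk_mass_bounds_domain by (auto split: split_indicator)
  have int: "integrable \<nu> (?f k)" for k
    using set_integrable_walk_mass by (simp add: set_integrable_def)
  have ae: "AE x in \<nu>. summable (\<lambda>k. norm (?f k x))"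
    using AE_summable_walk_mass[OF assms]
    by eventually_elim (simp only: norm_eq, auto split: split_indicator)
  have sm: "summable (\<lambda>k. LINT x|\<nu>. norm (?f k x))"
    using summable_g_seq[OF assms]
    by (simp only: norm_eq) (simp add: g_seq_eq[abs_def] set_lebesgue_integral_def)
  show "set_integrable \<nu> \<Omega> potential"
    using integrable_suminf[OF int ae sm] by (simp add: set_integrable_def indicator_potential)
  show "(LINT x:\<Omega>|\<nu>. potential x) = (\<Sum>k. g_seq \<nu> m \<Omega> k)"
    using integral_suminf[OF int ae sm] by (simp add: set_lebesgue_integral_def indicator_potential g_seq_eq)
qed

text \<open>Summable integrals give only L1. Square integrability comes from monotone convergence of
  the squared partial sums under their uniform L2 bound; it makes the potential admissible as a
  stress function and in \<open>killed_symmetric\<close>.\<close>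

lemma L2_on_potential:
  assumes "poincare2 \<nu> m \<Omega>"
  shows "potential \<in> L2_on \<nu> \<Omega>"
proof (rule L2_onI)
  show meas [measurable]: "(\<lambda>x. indicator \<Omega> x * potential x) \<in> borel_measurable \<nu>"
    using set_integral_potential(1)[OF assms] by (auto simp: set_integrable_def)
  obtain C where C: "\<And>n. (LINT x:\<Omega>|\<nu>. (\<Sum>k<n. w k x) * (\<Sum>k<n. w k x)) \<le> C"
    using sum_walk_mass_bound[OF assms] by blast
  define s where "s n x = indicator \<Omega> x * (\<Sum>k<n. w k x)" for n x
  have s_nonneg: "0 \<le> s n x" for n x
    using walk_mass_bounds_domain by (auto simp: s_def intro!: sum_nonneg split: split_indicator)
  have s_mono: "s n x \<le> s k x" if "n \<le> k" for n k x
    using that walk_mass_bounds_domain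
    by (auto simp: s_def intro!: sum_mono2 split: split_indicator)
  have int: "integrable \<nu> (\<lambda>x. (s n x)\<^sup>2)" for n
    using L2_onD(2)[OF L2_on_sum_walk_mass] by (simp add: s_def)
  have bound: "(LINT x|\<nu>. (s n x)\<^sup>2) \<le> C" for n
    using C[of n] unfolding set_integral_indicator_mult by (simp add: s_def power2_eq_square)
  have "incseq (\<lambda>n. LINT x|\<nu>. (s n x)\<^sup>2)"
    using int s_mono s_nonneg by (intro incseq_SucI integral_mono power_mono) auto
  then obtain L where L: "(\<lambda>n. LINT x|\<nu>. (s n x)\<^sup>2) \<longlonglongrightarrow> L"
    using bound incseq_convergent[of "\<lambda>n. LINT x|\<nu>. (s n x)\<^sup>2" C] by blast
  show "integrable \<nu> (\<lambda>x. (indicator \<Omega> x * potential x)\<^sup>2)"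
  proof (rule integral_monotone_convergence_nonneg(1)[OF int _ _ _ L])
    show "AE x in \<nu>. mono (\<lambda>n. (s n x)\<^sup>2)"
      using s_mono s_nonneg by (intro AE_I2 monoI power_mono) auto
    show "AE x in \<nu>. (\<lambda>n. (s n x)\<^sup>2) \<longlonglongrightarrow> (indicator \<Omega> x * potential x)\<^sup>2"
      using AE_summable_walk_mass[OF assms]
    proof eventually_elim
      case (elim x)
      then show ?case
        unfolding s_def potential_def
        by (intro tendsto_power) (auto intro!: summable_LIMSEQ split: split_indicator)
    qed
  qed auto
qed

text \<open>Applied termwise, \<open>killed\<close> drops the first term \<open>w 0 x = 1\<close>.
  The exchange of sum and integral uses convergence at x and at \<open>m x\<close>-almost every
  point of \<open>\<Omega>\<close>; the latter is \<open>AE_kernel\<close>.\<close>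

lemma potential_minus_killed:
  assumes "poincare2 \<nu> m \<Omega>"
  shows "AE x in \<nu>. x \<in> \<Omega> \<longrightarrow> potential x - killed potential x = 1"
  using AE_summable_walk_mass[OF assms] AE_kernel[OF AE_summable_walk_mass[OF assms]]
proof eventually_elim
  case (elim x)
  show ?case
  proof
    assume x: "x \<in> \<Omega>"
    let ?f = "\<lambda>k y. indicator \<Omega> y * w k y"
    have norm_eq: "norm (?f k y) = ?f k y" for k y
      using walk_mass_bounds_domain by (auto split: split_indicator)
    have int: "integrable (m x) (?f k)" for k
      using set_integrable_kernel_walk_mass x domain_space by (simp add: set_integrable_def)
    have ae: "AE y in m x. summable (\<lambda>k. norm (?f k y))"
      using elim(2) by eventually_elim (simp only: norm_eq, auto split: split_indicator)
    have w_Suc: "(LINT y|m x. ?f k y) = w (Suc k) x" for k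
      by (simp add: walk_mass.simps(2) set_lebesgue_integral_def)
    have summable: "summable (\<lambda>k. w k x)" using elim(1) x by simp
    then have "summable (\<lambda>k. LINT y|m x. norm (?f k y))"
      unfolding norm_eq w_Suc by (rule summable_Suc_iff[THEN iffD2])
    from integral_suminf[OF int ae this]
    have "(LINT y|m x. indicator \<Omega> y * potential y) = (\<Sum>k. w (Suc k) x)"
      unfolding w_Suc by (simp add: indicator_potential)
    then show "potential x - killed potential x = 1"
      using suminf_split_head[OF summable]
      by (simp add: killed_def set_lebesgue_integral_def potential_def)
  qed
qed

text \<open>The cut-off enforces the boundary condition, since the \<open>w k\<close> need not
  vanish off \<open>\<Omega>\<close> (\<open>w 0\<close> is 1 everywhere). It leaves
  \<open>killed\<close> unchanged, which sees only values on \<open>\<Omega>\<close>.\<close>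

lemma is_stress_function_potential:
  assumes "poincare2 \<nu> m \<Omega>"
  shows "is_stress_function \<nu> m \<Omega> (\<lambda>x. indicator \<Omega> x * potential x)"
proof -
  let ?f = "\<lambda>x. indicator \<Omega> x * potential x"
  have eq: "indicator (m_closure \<nu> m \<Omega>) x * ?f x = ?f x" for x
    using domain_subset_closure by (auto split: split_indicator)
  have f: "?f \<in> L2_on \<nu> (m_closure \<nu> m \<Omega>)"
    using L2_onD[OF L2_on_potential[OF assms]] by (intro L2_onI) (simp_all only: eq)
  have bd: "AE x in \<nu>. x \<in> m_boundary \<nu> m \<Omega> \<longrightarrow> ?f x = 0"
    by (auto simp: m_boundary_def)
  have killed_f: "killed ?f = killed potential"
    by (auto simp: killed_def set_lebesgue_integral_def fun_eq_iff split: split_indicator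
        intro!: Bochner_Integration.integral_cong)
  have "AE x in \<nu>. x \<in> \<Omega> \<longrightarrow> - (LINT y:m_closure \<nu> m \<Omega>|m x. ?f y - ?f x) = 1"
    using laplacian_eq_killed[OF f bd] potential_minus_killed[OF assms]
    by eventually_elim (auto simp: killed_f)
  with f bd show ?thesis by (simp add: is_stress_function_def)
qed

lemma torsional_rigidity_eq_suminf:
  assumes "poincare2 \<nu> m \<Omega>"
  shows "torsional_rigidity \<nu> m \<Omega> = (\<Sum>k. g_seq \<nu> m \<Omega> k)"
proof -
  define f where "f = stress_function \<nu> m \<Omega>"
  \<comment> \<open>The potential only certifies that a solution exists; from here on f is whichever
    solution was chosen.\<close>
  have "is_stress_function \<nu> m \<Omega> f"
    unfolding f_def stress_function_def
    by (rule someI[of "is_stress_function \<nu> m \<Omega>"]) (rule is_stress_function_potential[OF assms])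
  then have f_cl: "f \<in> L2_on \<nu> (m_closure \<nu> m \<Omega>)"
    and f_eq: "AE x in \<nu>. x \<in> \<Omega> \<longrightarrow> - (LINT y:m_closure \<nu> m \<Omega>|m x. f y - f x) = 1"
    and f_bd: "AE x in \<nu>. x \<in> m_boundary \<nu> m \<Omega> \<longrightarrow> f x = 0"
    by (auto simp: is_stress_function_def)
  have f: "f \<in> L2_on \<nu> \<Omega>" using f_cl by (rule L2_on_closureD)
  have f_stress: "AE x in \<nu>. x \<in> \<Omega> \<longrightarrow> f x - killed f x = 1"
    using f_eq laplacian_eq_killed[OF f_cl f_bd] by eventually_elim auto
  note pot = L2_on_potential[OF assms]
  note int_f = set_integrable_L2_on[OF f sets_domain finite_domain]
  note int_S = set_integrable_L2_on[OF pot sets_domain finite_domain]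
  note int_fS = set_integrable_mult_L2_on[OF f pot]
  note int_fKS = integrable_mult_killed[OF f pot]
  have int_KfS: "set_integrable \<nu> \<Omega> (\<lambda>x. killed f x * potential x)"
    using integrable_mult_killed[OF pot f] by (simp add: mult.commute)
  have "(LINT x:\<Omega>|\<nu>. f x) = (LINT x:\<Omega>|\<nu>. f x * potential x - f x * killed potential x)"
  proof (rule set_integral_cong_AE_integrable)
    show "AE x in \<nu>. x \<in> \<Omega> \<longrightarrow> f x = f x * potential x - f x * killed potential x"
      using potential_minus_killed[OF assms] by eventually_elim (auto simp flip: right_diff_distrib)
  qed (use int_f int_fS int_fKS in auto)
  also have "\<dots> = (LINT x:\<Omega>|\<nu>. f x * potential x - killed f x * potential x)"
    using int_fS int_fKS int_KfS killed_symmetric[OF f pot] by simp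
  also have "\<dots> = (LINT x:\<Omega>|\<nu>. potential x)"
  proof (rule set_integral_cong_AE_integrable)
    show "AE x in \<nu>. x \<in> \<Omega> \<longrightarrow> f x * potential x - killed f x * potential x = potential x"
      using f_stress by eventually_elim (auto simp flip: left_diff_distrib)
  qed (use int_S int_fS int_KfS in auto)
  also have "\<dots> = (\<Sum>k. g_seq \<nu> m \<Omega> k)" by (rule set_integral_potential(2)[OF assms])
  finally show ?thesis by (simp add: torsional_rigidity_def f_def)
qed

end

section \<open>The explicit heat solution\<close>

text \<open>For t \<ge> 0, the mean of \<open>a N\<close> with N Poisson of parameter t: the heat
  flow is the discrete walk run by a rate-one Poisson clock. The factorial sits with the coefficient
  so that the sum is a power series in t.\<close>

definition poisson_mean :: "(nat \<Rightarrow> real) \<Rightarrow> real \<Rightarrow> real" where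
  "poisson_mean a t = exp (- t) * (\<Sum>k. a k / fact k * t ^ k)"

lemma summable_poisson_mean:
  fixes t :: real
  assumes "\<And>k. \<bar>a k\<bar> \<le> B"
  shows "summable (\<lambda>k. a k / fact k * t ^ k)"
proof (rule summable_comparison_test)
  show "summable (\<lambda>k. B * (inverse (fact k) * \<bar>t\<bar> ^ k))"
    by (intro summable_mult summable_exp)
  show "\<exists>N. \<forall>k\<ge>N. norm (a k / fact k * t ^ k) \<le> B * (inverse (fact k) * \<bar>t\<bar> ^ k)"
    using assms by (auto simp: abs_mult power_abs divide_inverse mult.assoc intro!: mult_right_mono)
qed

lemma poisson_mean_bound:
  assumes "\<And>k. \<bar>a k\<bar> \<le> B" and "0 \<le> t"
  shows "\<bar>poisson_mean a t\<bar> \<le> B"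
proof -
  have sm: "summable (\<lambda>k. B * (inverse (fact k) * t ^ k))"
    by (intro summable_mult summable_exp)
  have le: "norm (a k / fact k * t ^ k) \<le> B * (inverse (fact k) * t ^ k)" for k
    using assms by (auto simp: abs_mult power_abs divide_inverse mult.assoc intro!: mult_right_mono)
  have "norm (\<Sum>k. a k / fact k * t ^ k) \<le> (\<Sum>k. B * (inverse (fact k) * t ^ k))"
    using le sm by (rule norm_suminf_le)
  also have "\<dots> = B * exp t"
    by (subst suminf_mult[OF summable_exp]) (simp add: exp_def)
  finally have "exp (- t) * \<bar>\<Sum>k. a k / fact k * t ^ k\<bar> \<le> exp (- t) * (B * exp t)"
    by (intro mult_left_mono) auto
  also have "\<dots> = B" by (simp add: exp_minus)
  finally show ?thesis by (simp only: poisson_mean_def abs_mult abs_exp_cancel)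
qed

lemma poisson_mean_0 [simp]: "poisson_mean a 0 = a 0"
  using powser_zero[of "\<lambda>k. a k / fact k"] by (simp add: poisson_mean_def)

text \<open>With factorials in the denominators, formal differentiation is the index shift; the
  factor \<open>exp (- t)\<close> contributes the subtracted term.\<close>

lemma poisson_mean_deriv:
  assumes "\<And>k. \<bar>a k\<bar> \<le> B"
  shows "(poisson_mean a has_real_derivative poisson_mean (\<lambda>k. a (Suc k)) t - poisson_mean a t) (at t)"
proof -
  have diffs: "diffs (\<lambda>k. a k / fact k) = (\<lambda>k. a (Suc k) / fact k)"
    by (auto simp: diffs_def fun_eq_iff divide_simps)
  have "((\<lambda>t. \<Sum>k. a k / fact k * t ^ k) has_real_derivative (\<Sum>k. a (Suc k) / fact k * t ^ k)) (at t)"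
    unfolding diffs[symmetric, THEN fun_cong]
    by (rule termdiffs_strong_converges_everywhere) (rule summable_poisson_mean[OF assms])
  then show ?thesis
    unfolding poisson_mean_def[abs_def]
    by (auto intro!: derivative_eq_intros simp: algebra_simps)
qed

text \<open>The derivative is a difference of two Poisson means bounded by 1, hence the constant 2,
  the same for all sequences a.\<close>

lemma poisson_mean_lipschitz:
  assumes a: "\<And>k. \<bar>a k\<bar> \<le> 1" and "0 \<le> s" "0 \<le> t"
  shows "\<bar>poisson_mean a s - poisson_mean a t\<bar> \<le> 2 * \<bar>s - t\<bar>"
proof -
  have "norm (poisson_mean a s - poisson_mean a t) \<le> 2 * norm (s - t)"
  proof (rule field_differentiable_bound[where S = "{0..}"])
    fix z :: real assume z: "z \<in> {0..}"
    show "(poisson_mean a has_real_derivative poisson_mean (\<lambda>k. a (Suc k)) z - poisson_mean a z)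
        (at z within {0..})"
      using poisson_mean_deriv[OF a] by (rule has_field_derivative_at_within)
    show "norm (poisson_mean (\<lambda>k. a (Suc k)) z - poisson_mean a z) \<le> 2"
      using poisson_mean_bound[of "\<lambda>k. a (Suc k)" 1 z] poisson_mean_bound[of a 1 z] a z by auto
  qed (use assms in auto)
  then show ?thesis by simp
qed

text \<open>The derivative is a difference of two 2-Lipschitz means, hence 4-Lipschitz; the mean
  value inequality is applied to the function minus its linear part at t. Uniformity in a means
  uniformity in x later, which turns pointwise derivatives into L2 derivatives.\<close>

lemma poisson_mean_difference_quotient:
  assumes a: "\<And>k. \<bar>a k\<bar> \<le> 1" and s: "0 \<le> s" and t: "0 \<le> t" and st: "s \<noteq> t"
  shows "\<bar>(poisson_mean a s - poisson_mean a t) / (s - t)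
      - (poisson_mean (\<lambda>k. a (Suc k)) t - poisson_mean a t)\<bar> \<le> 4 * \<bar>s - t\<bar>"
proof -
  let ?d = "\<lambda>r. poisson_mean (\<lambda>k. a (Suc k)) r - poisson_mean a r"
  let ?S = "closed_segment s t"
  have "norm ((poisson_mean a s - s * ?d t) - (poisson_mean a t - t * ?d t)) \<le> (4 * \<bar>s - t\<bar>) * norm (s - t)"
  proof (rule field_differentiable_bound[where S = ?S])
    fix z assume z: "z \<in> ?S"
    then have z0: "0 \<le> z" and zt: "\<bar>z - t\<bar> \<le> \<bar>s - t\<bar>"
      using s t by (auto simp: closed_segment_eq_real_ivl split: if_splits)
    show "((\<lambda>r. poisson_mean a r - r * ?d t) has_real_derivative ?d z - ?d t) (at z within ?S)"
      by (auto intro!: derivative_eq_intros has_field_derivative_at_within[OF poisson_mean_deriv[OF a]])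
    have "\<bar>poisson_mean (\<lambda>k. a (Suc k)) z - poisson_mean (\<lambda>k. a (Suc k)) t\<bar> \<le> 2 * \<bar>z - t\<bar>"
      "\<bar>poisson_mean a z - poisson_mean a t\<bar> \<le> 2 * \<bar>z - t\<bar>"
      using a z0 t by (auto intro!: poisson_mean_lipschitz)
    then show "norm (?d z - ?d t) \<le> 4 * \<bar>s - t\<bar>"
      using zt unfolding real_norm_def by (smt (verit))
  qed auto
  moreover have "(poisson_mean a s - poisson_mean a t) / (s - t) - ?d t
      = ((poisson_mean a s - s * ?d t) - (poisson_mean a t - t * ?d t)) / (s - t)"
    using st by (simp add: field_simps)
  ultimately show ?thesis
    using st by (simp add: abs_divide field_simps)
qed

lemma L2_tendsto_uniform:
  assumes A: "A \<in> sets M" "emeasure M A < \<infinity>"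
    and bound: "\<forall>\<^sub>F s in F. \<forall>x\<in>A. \<bar>u s x - f x\<bar> \<le> r s" and r: "(r \<longlongrightarrow> 0) F"
  shows "L2_tendsto M A u f F"
  unfolding L2_tendsto_def
proof (rule tendsto_sandwich[OF _ _ tendsto_const])
  have "((\<lambda>s. ennreal ((r s)\<^sup>2 * measure M A)) \<longlongrightarrow> ennreal (0\<^sup>2 * measure M A)) F"
    by (intro tendsto_ennrealI tendsto_intros r)
  then show "((\<lambda>s. ennreal ((r s)\<^sup>2 * measure M A)) \<longlongrightarrow> 0) F" by simp
  show "\<forall>\<^sub>F s in F. (\<integral>\<^sup>+x\<in>A. ennreal ((u s x - f x)\<^sup>2) \<partial>M) \<le> ennreal ((r s)\<^sup>2 * measure M A)"
    using bound
  proof eventually_elim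
    case (elim s)
    have "(\<integral>\<^sup>+x\<in>A. ennreal ((u s x - f x)\<^sup>2) \<partial>M) \<le> (\<integral>\<^sup>+x\<in>A. ennreal ((r s)\<^sup>2) \<partial>M)"
    proof (intro nn_integral_mono)
      fix x
      have "(u s x - f x)\<^sup>2 \<le> (r s)\<^sup>2" if "x \<in> A"
        using elim that power_mono[of "\<bar>u s x - f x\<bar>" "r s" 2] by simp
      then show "ennreal ((u s x - f x)\<^sup>2) * indicator A x \<le> ennreal ((r s)\<^sup>2) * indicator A x"
        by (auto split: split_indicator intro: ennreal_leI)
    qed
    also have "\<dots> = ennreal ((r s)\<^sup>2 * measure M A)"
      using A by (simp add: nn_integral_cmult_indicator emeasure_eq_ennreal_measure less_top[symmetric] ennreal_mult)
    finally show ?case .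
  qed
qed (auto intro!: always_eventually)

lemma L2_tendsto_cong_AE:
  assumes "AE x in M. x \<in> A \<longrightarrow> f x = g x"
  shows "L2_tendsto M A u f F \<longleftrightarrow> L2_tendsto M A u g F"
proof -
  have "(\<integral>\<^sup>+x\<in>A. ennreal ((u s x - f x)\<^sup>2) \<partial>M) = (\<integral>\<^sup>+x\<in>A. ennreal ((u s x - g x)\<^sup>2) \<partial>M)" for s
    by (intro nn_integral_cong_AE) (use assms in eventually_elim, auto split: split_indicator)
  then show ?thesis by (simp add: L2_tendsto_def)
qed

section \<open>The series solution of the heat equation\<close>

context walk_domain
begin

text \<open>On \<open>\<Omega>\<close> this is exp(t(K - I)) applied to 1, expanded with K^k 1 =
  \<open>w k\<close>; the indicator imposes the boundary condition.\<close>

definition heat :: "real \<Rightarrow> 'a \<Rightarrow> real" where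
  "heat t x = indicator \<Omega> x * poisson_mean (\<lambda>k. w k x) t"

lemma abs_walk_mass: "x \<in> space \<nu> \<Longrightarrow> \<bar>w k x\<bar> \<le> 1"
  using walk_mass_bounds[of x k] by auto

text \<open>Termwise, \<open>killed\<close> replaces \<open>w k\<close> by \<open>w (Suc k)\<close>:
  the same shift that the time derivative produces in \<open>poisson_mean_deriv\<close>.\<close>

lemma killed_heat:
  assumes x: "x \<in> space \<nu>" and t: "0 \<le> t"
  shows "killed (heat t) x = poisson_mean (\<lambda>k. w (Suc k) x) t"
proof -
  let ?f = "\<lambda>k y. indicator \<Omega> y * w k y / fact k * t ^ k"
  have norm_eq: "norm (?f k y) = ?f k y" for k y
    using walk_mass_bounds_domain t by (auto split: split_indicator simp: abs_mult)
  have "integrable (m x) (\<lambda>y. indicator \<Omega> y * w k y)" for k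
    using set_integrable_kernel_walk_mass[OF x] by (simp add: set_integrable_def)
  then have int: "integrable (m x) (?f k)" for k
    by simp
  have ae: "AE y in m x. summable (\<lambda>k. norm (?f k y))"
    unfolding norm_eq
    by (intro AE_I2 summable_poisson_mean[where B = 1])
       (use x space_kernel_eq abs_walk_mass in \<open>auto split: split_indicator\<close>)
  have f_eq: "(LINT y|m x. ?f k y) = w (Suc k) x / fact k * t ^ k" for k
    by (simp add: walk_mass.simps(2) set_lebesgue_integral_def)
  have "summable (\<lambda>k. LINT y|m x. norm (?f k y))"
    unfolding norm_eq f_eq using x abs_walk_mass by (intro summable_poisson_mean)
  from integral_suminf[OF int ae this]
  have eq: "(LINT y|m x. (\<Sum>k. ?f k y)) = (\<Sum>k. w (Suc k) x / fact k * t ^ k)"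
    unfolding f_eq .
  have "indicator \<Omega> y * heat t y = exp (- t) * (\<Sum>k. ?f k y)" for y
    by (auto simp: heat_def poisson_mean_def split: split_indicator)
  then show ?thesis
    by (simp only: killed_def set_lebesgue_integral_def real_scaleR_def integral_mult_right_zero eq
        poisson_mean_def)
qed

lemma is_heat_solution_heat: "is_heat_solution \<nu> m \<Omega> heat"
proof -
  have abs_w: "\<bar>w k x\<bar> \<le> 1" if "x \<in> \<Omega>" for k x
    using that by (intro abs_walk_mass domain_space)
  have meas [measurable]: "heat t \<in> borel_measurable \<nu>" for t
    unfolding heat_def[abs_def] poisson_mean_def by measurable
  have L2: "heat t \<in> L2_on \<nu> (m_closure \<nu> m \<Omega>)" if "t \<ge> 0" for t
  proof (rule L2_on_bounded[where B = 1])
    show "\<bar>heat t x\<bar> \<le> 1" for x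
      using poisson_mean_bound[of "\<lambda>k. w k x", OF abs_w that]
      by (auto simp: heat_def split: split_indicator)
  qed (use finite_closure in auto)
  have bd: "AE x in \<nu>. x \<in> m_boundary \<nu> m \<Omega> \<longrightarrow> heat t x = 0" for t
    by (auto simp: heat_def m_boundary_def)
  have cont: "L2_tendsto \<nu> \<Omega> heat (heat t) (at t within {0..})" if t: "t \<ge> 0" for t
  proof (rule L2_tendsto_uniform[OF sets_domain finite_domain])
    show "\<forall>\<^sub>F s in at t within {0..}. \<forall>x\<in>\<Omega>. \<bar>heat s x - heat t x\<bar> \<le> 2 * \<bar>s - t\<bar>"
      using poisson_mean_lipschitz[OF abs_w _ t]
      by (auto simp: eventually_at_filter heat_def)
    have "((\<lambda>s. 2 * \<bar>s - t\<bar>) \<longlongrightarrow> 2 * \<bar>t - t\<bar>) (at t within {0..})"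
      by (intro tendsto_intros)
    then show "((\<lambda>s. 2 * \<bar>s - t\<bar>) \<longlongrightarrow> 0) (at t within {0..})" by simp
  qed
  have deriv: "L2_tendsto \<nu> \<Omega> (\<lambda>s x. (heat s x - heat t x) / (s - t))
      (\<lambda>x. LINT y:m_closure \<nu> m \<Omega>|m x. heat t y - heat t x) (at t)" if t: "t > 0" for t
  proof -
    let ?d = "\<lambda>x. poisson_mean (\<lambda>k. w (Suc k) x) t - poisson_mean (\<lambda>k. w k x) t"
    have "L2_tendsto \<nu> \<Omega> (\<lambda>s x. (heat s x - heat t x) / (s - t)) ?d (at t)"
    proof (rule L2_tendsto_uniform[OF sets_domain finite_domain])
      \<comment> \<open>The filter is two-sided, while the quotient estimate is for nonnegative
        times; near t > 0 these are all times.\<close>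
      have "\<forall>\<^sub>F s in at t. 0 < s" using order_tendstoD(1)[OF tendsto_ident_at t] .
      moreover have "\<forall>\<^sub>F s in at t. s \<noteq> t" by (simp add: eventually_at_filter)
      ultimately show "\<forall>\<^sub>F s in at t. \<forall>x\<in>\<Omega>. \<bar>(heat s x - heat t x) / (s - t) - ?d x\<bar> \<le> 4 * \<bar>s - t\<bar>"
      proof eventually_elim
        case (elim s)
        then show ?case
          using poisson_mean_difference_quotient[OF abs_w, of _ s t] t by (auto simp: heat_def)
      qed
      have "((\<lambda>s. 4 * \<bar>s - t\<bar>) \<longlongrightarrow> 4 * \<bar>t - t\<bar>) (at t)"
        by (intro tendsto_intros)
      then show "((\<lambda>s. 4 * \<bar>s - t\<bar>) \<longlongrightarrow> 0) (at t)" by simp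
    qed
    moreover have "AE x in \<nu>. x \<in> \<Omega> \<longrightarrow> ?d x = (LINT y:m_closure \<nu> m \<Omega>|m x. heat t y - heat t x)"
      using laplacian_eq_killed[OF L2[OF less_imp_le[OF t]] bd]
    proof eventually_elim
      case (elim x)
      show ?case
      proof
        assume x: "x \<in> \<Omega>"
        then have "killed (heat t) x = poisson_mean (\<lambda>k. w (Suc k) x) t"
          using t by (intro killed_heat domain_space) auto
        moreover have "heat t x = poisson_mean (\<lambda>k. w k x) t"
          using x by (simp add: heat_def)
        ultimately show "?d x = (LINT y:m_closure \<nu> m \<Omega>|m x. heat t y - heat t x)"
          using elim x by simp
      qed
    qed
    ultimately show ?thesis by (subst (asm) L2_tendsto_cong_AE) auto
  qed
  have "AE x in \<nu>. x \<in> \<Omega> \<longrightarrow> heat 0 x = 1" by (simp add: heat_def)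
  with L2 bd cont deriv show ?thesis by (simp add: is_heat_solution_def)
qed

end

section \<open>The heat content\<close>

text \<open>The hierarchy $a_k' = a_{k+1} - a_k$ determines $a_0$ from the initial values, because
  $e^s \sum_{k \le n} a_k(s) (t-s)^k/k!$ has derivative $e^s a_{n+1}(s) (t-s)^n/n!$.\<close>

lemma hierarchy_sums:
  fixes a :: "nat \<Rightarrow> real \<Rightarrow> real"
  assumes t: "0 < t"
    and cont: "\<And>k. continuous_on {0..t} (a k)"
    and deriv: "\<And>k s. 0 < s \<Longrightarrow> s < t \<Longrightarrow> (a k has_real_derivative a (Suc k) s - a k s) (at s)"
    and bound: "\<And>k s. 0 \<le> s \<Longrightarrow> s \<le> t \<Longrightarrow> \<bar>a k s\<bar> \<le> M"
  shows "(\<lambda>k. a k 0 / fact k * t ^ k) sums (exp t * a 0 t)"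
proof -
  define \<phi> where "\<phi> n s = exp s * (\<Sum>k\<le>n. a k s / fact k * (t - s) ^ k)" for n s
  have deriv_sum: "((\<lambda>s. \<Sum>k\<le>n. a k s / fact k * (t - s) ^ k) has_real_derivative
      a (Suc n) s / fact n * (t - s) ^ n - (\<Sum>k\<le>n. a k s / fact k * (t - s) ^ k)) (at s)"
    if s: "0 < s" "s < t" for n s
  proof (induction n)
    case 0
    show ?case using deriv[OF s, of 0] by simp
  next
    case (Suc n)
    have "((\<lambda>s. a (Suc n) s / fact (Suc n) * (t - s) ^ Suc n) has_real_derivative
        (a (Suc (Suc n)) s - a (Suc n) s) / fact (Suc n) * (t - s) ^ Suc n
        - a (Suc n) s / fact (Suc n) * (Suc n * (t - s) ^ n)) (at s)"
      using deriv[OF s, of "Suc n"]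
      by (auto intro!: derivative_eq_intros simp: diff_divide_distrib right_diff_distrib left_diff_distrib mult_ac simp del: fact_Suc power_Suc)
    \<comment> \<open>The negative part of the new term's derivative cancels the leftover top term
      of the induction hypothesis, so the sum telescopes.\<close>
    moreover have "a (Suc n) s / fact (Suc n) * (Suc n * (t - s) ^ n) = a (Suc n) s / fact n * (t - s) ^ n"
      by (simp add: divide_simps)
    ultimately have "((\<lambda>s. a (Suc n) s / fact (Suc n) * (t - s) ^ Suc n) has_real_derivative
        (a (Suc (Suc n)) s - a (Suc n) s) / fact (Suc n) * (t - s) ^ Suc n
        - a (Suc n) s / fact n * (t - s) ^ n) (at s)"
      by (simp only:)
    note sum_deriv = DERIV_add[OF Suc.IH this]
    have "a (Suc n) s / fact n * (t - s) ^ n - (\<Sum>k\<le>n. a k s / fact k * (t - s) ^ k)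
        + ((a (Suc (Suc n)) s - a (Suc n) s) / fact (Suc n) * (t - s) ^ Suc n
          - a (Suc n) s / fact n * (t - s) ^ n)
      = a (Suc (Suc n)) s / fact (Suc n) * (t - s) ^ Suc n - (\<Sum>k\<le>Suc n. a k s / fact k * (t - s) ^ k)"
      unfolding sum.atMost_Suc diff_divide_distrib left_diff_distrib by linarith
    with sum_deriv show ?case
      unfolding sum.atMost_Suc by (simp only:)
  qed
  have deriv_\<phi>: "(\<phi> n has_real_derivative exp s * (a (Suc n) s / fact n * (t - s) ^ n)) (at s)"
    if s: "0 < s" "s < t" for n s
    unfolding \<phi>_def[abs_def]
    by (rule DERIV_cong[OF DERIV_mult[OF DERIV_exp deriv_sum[OF s]]]) (simp add: algebra_simps)
  have cont_\<phi>: "continuous_on {0..t} (\<phi> n)" for n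
    unfolding \<phi>_def[abs_def] by (intro continuous_intros cont) auto
  \<comment> \<open>At s = t only the summand k = 0 survives, as \<open>0 ^ 0 = 1\<close>.\<close>
  have \<phi>_t: "\<phi> n t = exp t * a 0 t" for n
  proof -
    have "(\<Sum>k\<le>n. a k t / fact k * (t - t) ^ k) = (\<Sum>k\<in>{0}. a k t / fact k * (t - t) ^ k)"
      by (rule sum.mono_neutral_right) auto
    then show ?thesis by (simp add: \<phi>_def)
  qed
  \<comment> \<open>The mean value theorem compares \<open>\<phi> n 0\<close>, a partial sum, with
    \<open>\<phi> n t\<close>, its intended limit. The derivative involves \<open>a (Suc n)\<close>,
    so \<open>M\<close> has to be independent of the index; then the factor t^n / n! wins.\<close>
  have remainder: "norm ((\<Sum>k\<le>n. a k 0 / fact k * t ^ k) - exp t * a 0 t)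
      \<le> t * exp t * M * (inverse (fact n) * t ^ n)" for n
  proof -
    obtain l z where z: "0 < z" "z < t" and l: "DERIV (\<phi> n) z :> l"
      and eq: "\<phi> n t - \<phi> n 0 = (t - 0) * l"
      using MVT[OF t cont_\<phi>] deriv_\<phi> unfolding real_differentiable_def by blast
    have "l = exp z * (a (Suc n) z / fact n * (t - z) ^ n)"
      using DERIV_unique[OF l deriv_\<phi>[OF z]] .
    then have "\<bar>l\<bar> = exp z * (\<bar>a (Suc n) z\<bar> / fact n * (t - z) ^ n)"
      using z by (simp add: abs_mult)
    also have "\<dots> \<le> exp t * (M / fact n * t ^ n)"
      using z t bound[of z "Suc n"]
      by (intro mult_mono divide_right_mono power_mono) (auto intro!: mult_nonneg_nonneg divide_nonneg_nonneg)
    finally have "t * \<bar>l\<bar> \<le> t * (exp t * (M / fact n * t ^ n))"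
      using t by (intro mult_left_mono) auto
    moreover have "\<bar>(\<Sum>k\<le>n. a k 0 / fact k * t ^ k) - exp t * a 0 t\<bar> = t * \<bar>l\<bar>"
      using eq t \<phi>_t[of n] by (simp add: \<phi>_def abs_mult abs_minus_commute)
    ultimately show ?thesis unfolding real_norm_def by (simp add: divide_inverse mult_ac)
  qed
  have "(\<lambda>n. t * exp t * M * (inverse (fact n) * t ^ n)) \<longlonglongrightarrow> t * exp t * M * 0"
    by (intro tendsto_mult_left summable_LIMSEQ_zero[OF summable_exp])
  then have "(\<lambda>n. t * exp t * M * (inverse (fact n) * t ^ n)) \<longlonglongrightarrow> 0"
    by (simp only: mult_zero_right)
  then have "(\<lambda>n. (\<Sum>k\<le>n. a k 0 / fact k * t ^ k) - exp t * a 0 t) \<longlonglongrightarrow> 0"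
    by (rule Lim_null_comparison[OF always_eventually[OF allI[OF remainder]]])
  then have "(\<lambda>n. \<Sum>k\<le>n. a k 0 / fact k * t ^ k) \<longlonglongrightarrow> exp t * a 0 t"
    by (rule LIM_zero_cancel)
  then show ?thesis
    by (simp add: sums_def LIMSEQ_lessThan_iff_atMost)
qed

text \<open>Serves the continuity in time of the L1 norm of a heat solution, the source of the
  uniform bound for \<open>hierarchy_sums\<close>.\<close>

lemma L2_tendsto_abs:
  assumes "L2_tendsto M A u f F"
  shows "L2_tendsto M A (\<lambda>s x. \<bar>u s x\<bar>) (\<lambda>x. \<bar>f x\<bar>) F"
  unfolding L2_tendsto_def
proof (rule tendsto_sandwich[OF _ _ tendsto_const])
  show "((\<lambda>s. \<integral>\<^sup>+x\<in>A. ennreal ((u s x - f x)\<^sup>2) \<partial>M) \<longlongrightarrow> 0) F"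
    using assms by (simp add: L2_tendsto_def)
  have "(\<bar>a\<bar> - \<bar>b\<bar>)\<^sup>2 \<le> (a - b)\<^sup>2" for a b :: real
    using power_mono[OF abs_triangle_ineq3[of a b], of 2] by simp
  then show "\<forall>\<^sub>F s in F. (\<integral>\<^sup>+x\<in>A. ennreal ((\<bar>u s x\<bar> - \<bar>f x\<bar>)\<^sup>2) \<partial>M)
      \<le> (\<integral>\<^sup>+x\<in>A. ennreal ((u s x - f x)\<^sup>2) \<partial>M)"
    by (intro always_eventually allI nn_integral_mono mult_right_mono ennreal_leI) auto
qed (auto intro!: always_eventually)

text \<open>Cauchy-Schwarz against the indicator of A, after discarding the factor \<open>g\<close>
  of modulus at most 1. Integrability of \<open>u s\<close> is asked only eventually because heat
  solutions are controlled only at nonnegative times.\<close>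

lemma L2_tendsto_integral:
  fixes g :: "'a \<Rightarrow> real"
  assumes lim: "L2_tendsto M A u f F" and A: "A \<in> sets M" "emeasure M A < \<infinity>"
    and u: "\<forall>\<^sub>F s in F. set_integrable M A (u s)" and f: "set_integrable M A f"
    and g: "g \<in> borel_measurable M" "\<And>x. x \<in> A \<Longrightarrow> \<bar>g x\<bar> \<le> 1"
  shows "((\<lambda>s. LINT x:A|M. u s x * g x) \<longlongrightarrow> (LINT x:A|M. f x * g x)) F"
proof (rule LIM_zero_cancel, rule Lim_null_comparison)
  define D where "D s = (\<integral>\<^sup>+x\<in>A. ennreal ((u s x - f x)\<^sup>2) \<partial>M)" for s
  have D: "(D \<longlongrightarrow> 0) F" using lim by (simp add: L2_tendsto_def D_def[abs_def])
  have "((\<lambda>s. sqrt (enn2real (D s) * measure M A)) \<longlongrightarrow> sqrt (enn2real 0 * measure M A)) F"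
    by (intro tendsto_intros tendsto_enn2real) (use D in auto)
  then show "((\<lambda>s. sqrt (enn2real (D s) * measure M A)) \<longlongrightarrow> 0) F" by simp
  \<comment> \<open>Any finite bound would do: it keeps \<open>enn2real\<close> from collapsing an
    infinite \<open>D s\<close> to 0.\<close>
  have "\<forall>\<^sub>F s in F. D s < 1" using order_tendstoD(2)[OF D, of 1] by simp
  with u show "\<forall>\<^sub>F s in F. norm ((LINT x:A|M. u s x * g x) - (LINT x:A|M. f x * g x))
      \<le> sqrt (enn2real (D s) * measure M A)"
  proof eventually_elim
    case (elim s)
    have mult_g: "set_integrable M A (\<lambda>x. h x * g x)" if "set_integrable M A h" for h :: "'a \<Rightarrow> real"
    proof -
      have h: "integrable M (\<lambda>x. indicator A x * h x)" using that by (simp add: set_integrable_def)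
      have "integrable M (\<lambda>x. (indicator A x * h x) * (indicator A x * g x))"
      proof (rule Bochner_Integration.integrable_bound[OF h])
        show "AE x in M. norm ((indicator A x * h x) * (indicator A x * g x)) \<le> norm (indicator A x * h x)"
          using g(2) by (intro AE_I2) (auto simp: abs_mult mult_left_le split: split_indicator)
      qed (use h g(1) A(1) in \<open>auto intro!: borel_measurable_times\<close>)
      moreover have "(\<lambda>x. indicator A x *\<^sub>R (h x * g x)) = (\<lambda>x. (indicator A x * h x) * (indicator A x * g x))"
        by (auto split: split_indicator)
      ultimately show ?thesis by (simp add: set_integrable_def)
    qed
    have d: "set_integrable M A (\<lambda>x. u s x - f x)" using elim(1) f by simp
    then have dM [measurable]: "(\<lambda>x. indicator A x * (u s x - f x)) \<in> borel_measurable M"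
      by (auto simp: set_integrable_def)
    have abs_d: "set_integrable M A (\<lambda>x. \<bar>u s x - f x\<bar>)"
      using set_integrable_abs[OF d] .
    note [measurable] = A(1)
    have "(LINT x:A|M. u s x * g x) - (LINT x:A|M. f x * g x) = (LINT x:A|M. (u s x - f x) * g x)"
      using mult_g[OF elim(1)] mult_g[OF f] by (simp add: left_diff_distrib)
    also have "norm \<dots> \<le> (LINT x:A|M. \<bar>(u s x - f x) * g x\<bar>)"
      unfolding real_norm_def set_lebesgue_integral_def
      by (rule order_trans[OF integral_abs_bound]) (simp add: abs_mult)
    also have "\<dots> \<le> (LINT x:A|M. \<bar>u s x - f x\<bar>)"
      using g(2) abs_d set_integrable_abs[OF mult_g[OF d]]
      by (intro set_integral_mono) (auto simp: abs_mult mult_left_le)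
    finally have le: "norm ((LINT x:A|M. u s x * g x) - (LINT x:A|M. f x * g x)) \<le> (LINT x:A|M. \<bar>u s x - f x\<bar>)" .
    have eq: "(\<integral>\<^sup>+x. ennreal \<bar>indicator A x * (u s x - f x)\<bar> * indicator A x \<partial>M)
        = ennreal (LINT x:A|M. \<bar>u s x - f x\<bar>)"
    proof -
      have "(\<integral>\<^sup>+x. ennreal \<bar>indicator A x * (u s x - f x)\<bar> * indicator A x \<partial>M)
          = (\<integral>\<^sup>+x. ennreal (indicator A x *\<^sub>R \<bar>u s x - f x\<bar>) \<partial>M)"
        by (intro nn_integral_cong) (auto split: split_indicator)
      also have "\<dots> = ennreal (LINT x:A|M. \<bar>u s x - f x\<bar>)"
        using abs_d unfolding set_integrable_def set_lebesgue_integral_def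
        by (rule nn_integral_eq_integral) auto
      finally show ?thesis .
    qed
    have "(ennreal (LINT x:A|M. \<bar>u s x - f x\<bar>))\<^sup>2
        \<le> (\<integral>\<^sup>+x. (ennreal \<bar>indicator A x * (u s x - f x)\<bar>)\<^sup>2 \<partial>M) * (\<integral>\<^sup>+x. (indicator A x)\<^sup>2 \<partial>M)"
      unfolding eq[symmetric] by (rule Cauchy_Schwarz_nn_integral) measurable
    also have "(\<integral>\<^sup>+x. (ennreal \<bar>indicator A x * (u s x - f x)\<bar>)\<^sup>2 \<partial>M) = D s"
      unfolding D_def by (intro nn_integral_cong) (auto simp: ennreal_power split: split_indicator)
    also have "(\<integral>\<^sup>+x. (indicator A x)\<^sup>2 \<partial>M) = (\<integral>\<^sup>+x. indicator A x \<partial>M)"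
      by (intro nn_integral_cong) (auto split: split_indicator)
    also have "\<dots> = ennreal (measure M A)"
      using A by (simp add: emeasure_eq_ennreal_measure less_top[symmetric])
    also have "D s = ennreal (enn2real (D s))"
      using elim(2) by (simp add: order_less_trans[OF _ ennreal_one_less_top])
    finally have "ennreal ((LINT x:A|M. \<bar>u s x - f x\<bar>)\<^sup>2) \<le> ennreal (enn2real (D s) * measure M A)"
      by (simp add: ennreal_power ennreal_mult set_lebesgue_integral_def Bochner_Integration.integral_nonneg)
    then have "(LINT x:A|M. \<bar>u s x - f x\<bar>)\<^sup>2 \<le> enn2real (D s) * measure M A"
      by (simp add: ennreal_le_iff)
    then have "(LINT x:A|M. \<bar>u s x - f x\<bar>) \<le> sqrt (enn2real (D s) * measure M A)"
      by (rule real_le_rsqrt)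
    with le show ?case by simp
  qed
qed

section \<open>Heat content of an arbitrary solution\<close>

context walk_domain
begin

lemma heat_content_eq:
  assumes v: "is_heat_solution \<nu> m \<Omega> v" and t: "0 \<le> t"
  shows "(LINT x:\<Omega>|\<nu>. v t x) = poisson_mean (g_seq \<nu> m \<Omega>) t"
proof -
  have v_cl: "v s \<in> L2_on \<nu> (m_closure \<nu> m \<Omega>)" if "0 \<le> s" for s
    using v that by (simp add: is_heat_solution_def)
  have v_bd: "AE x in \<nu>. x \<in> m_boundary \<nu> m \<Omega> \<longrightarrow> v s x = 0" if "0 < s" for s
    using v that by (simp add: is_heat_solution_def)
  have v_L2: "v s \<in> L2_on \<nu> \<Omega>" if "0 \<le> s" for s
    using v_cl[OF that] by (rule L2_on_closureD)
  have v_int: "set_integrable \<nu> \<Omega> (v s)" if "0 \<le> s" for s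
    using v_L2[OF that] sets_domain finite_domain by (rule set_integrable_L2_on)
  have vw_int: "set_integrable \<nu> \<Omega> (\<lambda>x. v s x * w k x)" if "0 \<le> s" for s k
    using v_L2[OF that] L2_on_walk_mass by (rule set_integrable_mult_L2_on)
  have v_cont: "L2_tendsto \<nu> \<Omega> v (v s) (at s within {0..})" if "0 \<le> s" for s
    using v that by (simp add: is_heat_solution_def)
  have v_deriv: "L2_tendsto \<nu> \<Omega> (\<lambda>r x. (v r x - v s x) / (r - s)) (\<lambda>x. killed (v s) x - v s x) (at s)"
    if "0 < s" for s
  proof -
    have "L2_tendsto \<nu> \<Omega> (\<lambda>r x. (v r x - v s x) / (r - s))
        (\<lambda>x. LINT y:m_closure \<nu> m \<Omega>|m x. v s y - v s x) (at s)"
      using v that by (simp add: is_heat_solution_def)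
    moreover have "AE x in \<nu>. x \<in> \<Omega> \<longrightarrow>
        (LINT y:m_closure \<nu> m \<Omega>|m x. v s y - v s x) = killed (v s) x - v s x"
      using that by (intro laplacian_eq_killed v_cl v_bd) auto
    ultimately show ?thesis by (subst (asm) L2_tendsto_cong_AE)
  qed
  have w_le: "\<bar>w k x\<bar> \<le> 1" if "x \<in> \<Omega>" for k x
    using that by (intro abs_walk_mass domain_space)
  define a where "a k s = (LINT x:\<Omega>|\<nu>. v s x * w k x)" for k s
  have a_0: "a k 0 = g_seq \<nu> m \<Omega> k" for k
    unfolding a_def g_seq_eq
  proof (rule set_integral_cong_AE_integrable)
    have "AE x in \<nu>. x \<in> \<Omega> \<longrightarrow> v 0 x = 1" using v by (simp add: is_heat_solution_def)
    then show "AE x in \<nu>. x \<in> \<Omega> \<longrightarrow> v 0 x * w k x = w k x" by eventually_elim auto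
  qed (use vw_int set_integrable_walk_mass in auto)
  have content: "(LINT x:\<Omega>|\<nu>. v s x) = a 0 s" for s by (simp add: a_def)
  show ?thesis
  \<comment> \<open>\<open>hierarchy_sums\<close> works on an interval of positive length, so the
    initial time is read off from the initial condition.\<close>
  proof (cases "t = 0")
    case True
    then show ?thesis by (simp add: content a_0)
  next
    case False
    with t have t: "0 < t" by simp
    have ev_int: "\<forall>\<^sub>F r in at s within {0..}. set_integrable \<nu> \<Omega> (v r)" for s
      by (auto simp: eventually_at_filter v_int)
    have cont: "continuous_on {0..t} (a k)" for k
      unfolding continuous_on_def
    proof
      fix s assume s: "s \<in> {0..t}"
      have "(a k \<longlongrightarrow> a k s) (at s within {0..})"
        unfolding a_def[abs_def] using s
        by (intro L2_tendsto_integral[OF v_cont sets_domain finite_domain ev_int] v_int w_le) auto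
      then show "(a k \<longlongrightarrow> a k s) (at s within {0..t})" by (rule tendsto_within_subset) auto
    qed
    have deriv: "(a k has_real_derivative a (Suc k) s - a k s) (at s)" if s: "0 < s" "s < t" for k s
    proof -
      have pos: "\<forall>\<^sub>F r in at s. 0 < r" using order_tendstoD(1)[OF tendsto_ident_at s(1)] .
      have int: "\<forall>\<^sub>F r in at s. set_integrable \<nu> \<Omega> (\<lambda>x. (v r x - v s x) / (r - s))"
        using pos by eventually_elim (use s in \<open>simp add: v_int\<close>)
      have Kv: "set_integrable \<nu> \<Omega> (\<lambda>x. killed (v s) x - v s x)"
        using s by (intro set_integral_diff integrable_killed v_L2 v_int) auto
      have Kv_w: "set_integrable \<nu> \<Omega> (\<lambda>x. killed (v s) x * w k x)"
        using integrable_mult_killed[OF L2_on_walk_mass v_L2, of s k] s by (simp add: mult.commute)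
      have lim: "((\<lambda>r. LINT x:\<Omega>|\<nu>. (v r x - v s x) / (r - s) * w k x)
          \<longlongrightarrow> (LINT x:\<Omega>|\<nu>. (killed (v s) x - v s x) * w k x)) (at s)"
        by (rule L2_tendsto_integral[OF v_deriv[OF s(1)] sets_domain finite_domain int Kv
              measurable_walk_mass w_le])
      have quot: "\<forall>\<^sub>F r in at s. (LINT x:\<Omega>|\<nu>. (v r x - v s x) / (r - s) * w k x)
          = (a k r - a k s) / (r - s)"
        using pos
      proof eventually_elim
        case (elim r)
        have "(LINT x:\<Omega>|\<nu>. (v r x - v s x) / (r - s) * w k x)
            = (LINT x:\<Omega>|\<nu>. (v r x * w k x - v s x * w k x) / (r - s))"
          by (simp add: left_diff_distrib)
        also have "\<dots> = (a k r - a k s) / (r - s)"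
          using vw_int elim s by (simp add: a_def)
        finally show ?case .
      qed
      \<comment> \<open>Symmetry moves \<open>killed\<close> from \<open>v s\<close> onto
        \<open>w k\<close>, where it raises the index; this closes the hierarchy.\<close>
      have "(LINT x:\<Omega>|\<nu>. (killed (v s) x - v s x) * w k x) = a (Suc k) s - a k s"
        using Kv_w vw_int[of s k] s killed_symmetric[OF v_L2 L2_on_walk_mass, of s k]
        by (simp add: left_diff_distrib a_def killed_walk_mass)
      with Lim_transform_eventually[OF lim quot]
      have "((\<lambda>r. (a k r - a k s) / (r - s)) \<longlongrightarrow> a (Suc k) s - a k s) (at s)"
        by (simp only:)
      then show ?thesis by (simp add: has_field_derivative_iff)
    qed
    \<comment> \<open>Every pairing is bounded by this L1 norm, since \<open>w k\<close> lies
      between 0 and 1; continuity on a compact interval gives one bound for all k and s. The factor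
      1 is the test function.\<close>
    have "continuous_on {0..t} (\<lambda>s. LINT x:\<Omega>|\<nu>. \<bar>v s x\<bar> * 1)"
      unfolding continuous_on_def
    proof
      fix s assume s: "s \<in> {0..t}"
      have "\<forall>\<^sub>F r in at s within {0..}. set_integrable \<nu> \<Omega> (\<lambda>x. \<bar>v r x\<bar>)"
        using ev_int by eventually_elim (rule set_integrable_abs)
      then have "((\<lambda>s. LINT x:\<Omega>|\<nu>. \<bar>v s x\<bar> * 1) \<longlongrightarrow> (LINT x:\<Omega>|\<nu>. \<bar>v s x\<bar> * 1)) (at s within {0..})"
        using s by (intro L2_tendsto_integral[OF L2_tendsto_abs[OF v_cont] sets_domain finite_domain]
            set_integrable_abs v_int) auto
      then show "((\<lambda>s. LINT x:\<Omega>|\<nu>. \<bar>v s x\<bar> * 1) \<longlongrightarrow> (LINT x:\<Omega>|\<nu>. \<bar>v s x\<bar> * 1)) (at s within {0..t})"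
        by (rule tendsto_within_subset) auto
    qed
    then have "bounded ((\<lambda>s. LINT x:\<Omega>|\<nu>. \<bar>v s x\<bar> * 1) ` {0..t})"
      by (intro compact_imp_bounded compact_continuous_image) auto
    then obtain M where M: "\<forall>s\<in>{0..t}. \<bar>LINT x:\<Omega>|\<nu>. \<bar>v s x\<bar>\<bar> \<le> M"
      by (auto simp: bounded_iff)
    have bound: "\<bar>a k s\<bar> \<le> M" if s: "0 \<le> s" "s \<le> t" for k s
    proof -
      have "\<bar>a k s\<bar> \<le> (LINT x:\<Omega>|\<nu>. \<bar>v s x * w k x\<bar>)"
        unfolding a_def set_lebesgue_integral_def
        by (rule order_trans[OF integral_abs_bound]) (simp add: abs_mult)
      also have "\<dots> \<le> (LINT x:\<Omega>|\<nu>. \<bar>v s x\<bar>)"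
        using w_le set_integrable_abs[OF vw_int] set_integrable_abs[OF v_int] s
        by (intro set_integral_mono) (auto simp: abs_mult mult_left_le)
      also have "\<dots> \<le> M" using M s by force
      finally show ?thesis .
    qed
    have "(\<lambda>k. g_seq \<nu> m \<Omega> k / fact k * t ^ k) sums (exp t * a 0 t)"
      using hierarchy_sums[of t a M, OF t cont deriv bound] by (simp add: a_0)
    then show ?thesis
      by (simp add: poisson_mean_def content exp_minus sums_iff)
  qed
qed

lemma spectral_heat_content_eq:
  assumes "0 \<le> t"
  shows "spectral_heat_content \<nu> m \<Omega> t = poisson_mean (g_seq \<nu> m \<Omega>) t"
  unfolding spectral_heat_content_def heat_solution_def
  by (rule heat_content_eq[OF someI[of "is_heat_solution \<nu> m \<Omega>"] assms]) (rule is_heat_solution_heat)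

end

text \<open>By the Gamma integral each Poisson weight e^(-t) t^k / k! has integral 1 over [0,
  infinity). Nonnegativity and summability of a justify termwise integration, and summability also
  bounds a, so that the series converges for each t.\<close>

lemma integral_poisson_mean:
  assumes nonneg: "\<And>k. 0 \<le> a k" and sm: "summable a"
  shows "set_integrable lborel {0..} (poisson_mean a)"
    and "(LINT t:{0..}|lborel. poisson_mean a t) = (\<Sum>k. a k)"
proof -
  let ?h = "\<lambda>k t. a k / fact k * (t ^ k * exp (- t) * indicator {0..} t) :: real"
  have norm_h: "norm (?h k t) = ?h k t" for k t
    using nonneg by (auto split: split_indicator)
  obtain B where B: "\<And>k. \<bar>a k\<bar> \<le> B"
    using summable_imp_bounded[OF sm] by (auto simp: bounded_iff)
  have nn: "(\<integral>\<^sup>+t. ennreal (t ^ k * exp (- t) * indicator {0..} t) \<partial>lborel) = ennreal (fact k)" for k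
    using nn_intergal_power_times_exp_Ici[of k]
    by (simp add: ennreal_mult'' ennreal_indicator)
  have int: "integrable lborel (\<lambda>t. t ^ k * exp (- t) * indicator {0..} t :: real)" for k
    using nn by (intro integrableI_nn_integral_finite[where x = "fact k"]) (auto split: split_indicator)
  have integral: "(LINT t|lborel. t ^ k * exp (- t) * indicator {0..} t) = (fact k :: real)" for k
    using nn by (subst integral_eq_nn_integral) (auto split: split_indicator)
  have int_h: "integrable lborel (?h k)" for k using int by simp
  have integral_h: "(LINT t|lborel. ?h k t) = a k" for k
    by (simp add: integral)
  have sum_h: "(\<Sum>k. ?h k t) = indicator {0..} t *\<^sub>R poisson_mean a t" for t
  proof (cases "t \<ge> 0")
    case True
    have "(\<Sum>k. ?h k t) = (\<Sum>k. exp (- t) * (a k / fact k * t ^ k))"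
      using True by (simp add: mult_ac)
    also have "\<dots> = poisson_mean a t"
      unfolding poisson_mean_def by (rule suminf_mult) (rule summable_poisson_mean[OF B])
    finally show ?thesis using True by simp
  qed simp
  have ae: "AE t in lborel. summable (\<lambda>k. norm (?h k t))"
  proof (intro AE_I2)
    fix t :: real
    have "summable (\<lambda>k. (exp (- t) * indicator {0..} t) * (a k / fact k * t ^ k))"
      by (intro summable_mult summable_poisson_mean[OF B])
    then show "summable (\<lambda>k. norm (?h k t))"
      unfolding norm_h by (simp add: mult_ac)
  qed
  have sm_h: "summable (\<lambda>k. LINT t|lborel. norm (?h k t))"
    unfolding norm_h integral_h by (rule sm)
  show "set_integrable lborel {0..} (poisson_mean a)"
    using integrable_suminf[OF int_h ae sm_h] unfolding set_integrable_def sum_h .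
  show "(LINT t:{0..}|lborel. poisson_mean a t) = (\<Sum>k. a k)"
    using integral_suminf[OF int_h ae sm_h] unfolding set_lebesgue_integral_def sum_h integral_h .
qed

theorem theorem3p6:
  fixes \<nu> :: "'a measure" and m :: "'a \<Rightarrow> 'a measure" and \<Omega> :: "'a set"
  assumes "reversible_random_walk_space \<nu> m"
    and "\<Omega> \<in> sets \<nu>"
    and "m_connected \<nu> m \<Omega>"
    and "0 < emeasure \<nu> \<Omega>"
    and "emeasure \<nu> \<Omega> < emeasure \<nu> (m_closure \<nu> m \<Omega>)"
    and "emeasure \<nu> (m_closure \<nu> m \<Omega>) < \<infinity>"
    and "poincare2 \<nu> m \<Omega>"
  shows "(set_integrable lborel {0..} (spectral_heat_content \<nu> m \<Omega>) \<and>
          torsional_rigidity \<nu> m \<Omega> = (LINT t:{0..}|lborel. spectral_heat_content \<nu> m \<Omega> t)) \<and>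
         (summable (g_seq \<nu> m \<Omega>) \<and>
          torsional_rigidity \<nu> m \<Omega> = (\<Sum>k. g_seq \<nu> m \<Omega> k))"
proof -
  have "space \<nu> \<noteq> {}"
    using assms(2,4) sets.sets_into_space by fastforce
  then interpret walk_domain \<nu> m \<Omega>
    using assms by unfold_locales (auto simp: reversible_random_walk_space_def random_walk_def)
  note sm = summable_g_seq[OF assms(7)]
  note T = torsional_rigidity_eq_suminf[OF assms(7)]
  note Q = integral_poisson_mean[OF g_seq_nonneg sm]
  have "set_integrable lborel {0..} (spectral_heat_content \<nu> m \<Omega>)"
    \<comment> \<open>The formula is available for t \<ge> 0 only, which is all that integration
      over \<open>{0..}\<close> sees.\<close>
    using Q(1) by (subst set_integrable_cong[OF refl refl spectral_heat_content_eq]) auto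
  moreover have "(LINT t:{0..}|lborel. spectral_heat_content \<nu> m \<Omega> t)
      = (LINT t:{0..}|lborel. poisson_mean (g_seq \<nu> m \<Omega>) t)"
    by (rule set_lebesgue_integral_cong) (auto simp: spectral_heat_content_eq)
  ultimately show ?thesis using sm T Q(2) by simp
qed

end
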